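(* Fix $h\in\mathbb C^\times$, let $U\subseteq\mathbb C$ be half-step-invariant, and let $X:U\to\mathbb C$ be an admissible map belonging to the ordinary quadratic half-step branch; thus there is a global constant $a\in\mathbb C$ such that $$Y+Z=2X+\frac a2$$ throughout $U$. Let $D,S:\mathcal P\to\mathcal P$ be the associated divided-difference and averaging operators, with transposes $\mathbf D,\mathbf S:\mathcal P'\to\mathcal P'$. Let $\mathbf u\in\mathcal P'$ be such that $\langle\mathbf u,1\rangle\neq0$, and assume that there exist polynomials $\phi(x)=\phi_2x^2+\phi_1x+\phi_0$ and $\psi(x)=\psi_1x+\psi_0$, not both identically zero, such that $$\mathbf D(\phi\,\mathbf u)=\mathbf S(\psi\,\mathbf u)$$ in $\mathcal P'$. Fix $s_0\in U$ and write $X(s_0+kh)=ak^2+b_{s_0}k+c_{s_0}$ for every $k\in\mathbb Z$, with the same global coefficient $a$. Set $$d_n=\phi_2n+\psi_1,\qquad e_n=\phi_1n+\psi_0+\tfrac12a\psi_1n^2,$$ $$\phi^{[n]}(x)=\phi_2x^2+\left(\phi_1+\tfrac32an\,d_n\right)x+\phi\!\left(\tfrac14an^2\right)+\tfrac12an\,\psi\!\left(\tfrac14an^2\right)+\tfrac n4\bigl(b_{s_0}^2-4ac_{s_0}\bigr)d_n.$$ (Infinite case, $I=\mathbb N$.) There exists a monic orthogonal polynomial sequence $(P_n)_{n\in\mathbb N}$ with respect to $\mathbf u$ if and only if $$d_j\neq0\ (j\in\mathbb N)\quad\text{and}\quad\phi^{[n]}\!\left(-\tfrac14an^2-\frac{e_n}{d_{2n}}\right)\neq0\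 (n\in\mathbb N).$$ (Finite case, $I=\{0,1,\dots,N+1\}$ with $N\in\mathbb N$.) Assume $d_j\neq0$ for $j=0,1,\dots,2N+1$. Then there exists a monic orthogonal polynomial sequence $(P_n)_{n\in I}$ with respect to $\mathbf u$ if and only if $$\phi^{[n]}\!\left(-\tfrac14an^2-\frac{e_n}{d_{2n}}\right)\neq0,\qquad n=0,1,\dots,N.$$ Put $K_I=\mathbb N$ in the infinite case and $K_I=\{0,1,\dots,N\}$ in the finite case. Whenever the non-vanishing conditions displayed for the respective case hold, the monic orthogonal polynomial sequence is uniquely determined by $P_{-1}=0$, $P_0=1$ and $$P_{n+1}(x)=(x-B_n)P_n(x)-C_nP_{n-1}(x),\qquad n\in K_I$$ (the term $C_0P_{-1}$ being void), where $$B_0=-\frac{e_0}{d_0},\qquad C_1=-\frac1{d_1}\,\phi^{[0]}\!\left(-\frac{e_0}{d_0}\right),$$ and, for every $n\in K_I\setminus\{0\}$, $$B_n=\frac{n\,e_{n-1}}{d_{2n-2}}-\frac{(n+1)e_n}{d_{2n}}-\tfrac12an(n-1),\qquad C_{n+1}=-\frac{(n+1)d_{n-1}}{d_{2n-1}d_{2n+1}}\,\phi^{[n]}\!\left(-\tfrac14an^2-\frac{e_n}{d_{2n}}\right).$$ In the finite case the last coefficient $C_{N+1}$ is the terminal norm coefficient $\langle\mathbf u,P_{N+1}^2\rangle/\langle\mathbf u,P_N^2\rangle$; it is not used to construct a polynomial $P_{N+2}$.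
   Context: $\mathbb N=\{0,1,2,\dots\}$, $\mathbb C^\times=\mathbb C\setminus\{0\}$. Fix $h\in\mathbb C^\times$. A non-empty set $U\subseteq\mathbb C$ is half-step-invariant if $U\pm\frac h2\subseteq U$. For $X:U\to\mathbb C$ put $Y(s)=X(s+\frac h2)$, $Z(s)=X(s-\frac h2)$. $X$ is parametrising if $Y-Z$ vanishes nowhere on $U$; it is admissible if moreover $X(U)$ is infinite and for every complex polynomial $p$ of degree $\ge1$ there is a polynomial $Q$ with $\deg Q\le\deg p-1$ and $\frac{p(Y)-p(Z)}{Y-Z}=Q(X)$ throughout $U$. $\mathcal P$ is the space of complex polynomials, the inductive limit of the finite-dimensional spaces $\mathcal P_n$ of polynomials of degree at most $n$; its continuous dual $\mathcal P'$ coincides with the space of all linear functionals on $\mathcal P$. For admissible $X$, $Dp$ and $Sp$ are the unique polynomials with $(Dp)(X)=\frac{p(Y)-p(Z)}{Y-Z}$ and $(Sp)(X)=\frac{p(Y)+p(Z)}2$ throughout $U$. On $\mathcal P'$: $\langle p_0\mathbf u,p\rangle=\langle\mathbf u,p_0p\rangle$, $\langle\mathbf D\mathbf u,p\rangle=-\langle\mathbf u,Dp\rangle$, $\langle\mathbf S\mathbf u,p\rangle=\langle\mathbf u,Sp\rangle$. A family $(P_n)_{n\in I}$ with $\deg P_n=n$ is orthogonal with respect to $\mathbf u$ if $\langle\mathbf u,P_nP_m\rangle=0$ for $m,n\in I$, $m<n$, and $\langle\mathbf u,P_n^2\rangle\neq0$ for $n\in I$. Branch: for admissible $X$ there are unique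 constants $\eta,\beta\in\mathbb C$ with $Y+Z=\eta X+\beta$ throughout $U$; the ordinary quadratic half-step branch is the case $\eta=2$. In that branch, with $a=2\beta$, for every $s_0\in U$ there are unique $b_{s_0},c_{s_0}\in\mathbb C$ with $X(s_0+kh)=ak^2+b_{s_0}k+c_{s_0}$ for all $k\in\mathbb Z$. *)

theory Defs
  imports Complex_Main "HOL-Computational_Algebra.Polynomial"
begin

text \<open>
  A map \<open>X : U \<rightarrow> \<complex>\<close> is a total function on the complex numbers of which only the
  values on \<open>U\<close> are used; half-step invariance keeps \<open>s \<plusminus> h/2\<close> inside \<open>U\<close>.
\<close>

definition half_step_invariant :: "complex \<Rightarrow> complex set \<Rightarrow> bool" where
  "half_step_invariant h U \<longleftrightarrow> U \<noteq> {} \<and> (\<forall>s\<in>U. s + h / 2 \<in> U \<and> s - h / 2 \<in> U)"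

definition fwd :: "complex \<Rightarrow> (complex \<Rightarrow> complex) \<Rightarrow> complex \<Rightarrow> complex" where
  "fwd h X s = X (s + h / 2)"

definition bwd :: "complex \<Rightarrow> (complex \<Rightarrow> complex) \<Rightarrow> complex \<Rightarrow> complex" where
  "bwd h X s = X (s - h / 2)"

definition parametrising :: "complex \<Rightarrow> complex set \<Rightarrow> (complex \<Rightarrow> complex) \<Rightarrow> bool" where
  "parametrising h U X \<longleftrightarrow> (\<forall>s\<in>U. fwd h X s - bwd h X s \<noteq> 0)"

definition admissible :: "complex \<Rightarrow> complex set \<Rightarrow> (complex \<Rightarrow> complex) \<Rightarrow> bool" where
  "admissible h U X \<longleftrightarrow> parametrising h U X \<and> infinite (X ` U) \<and>
     (\<forall>p :: complex poly. degree p \<ge> 1 \<longrightarrow>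
       (\<exists>Q. degree Q \<le> degree p - 1 \<and>
         (\<forall>s\<in>U. (poly p (fwd h X s) - poly p (bwd h X s)) / (fwd h X s - bwd h X s)
                  = poly Q (X s))))"

definition branch_law ::
  "complex \<Rightarrow> complex set \<Rightarrow> (complex \<Rightarrow> complex) \<Rightarrow> complex \<Rightarrow> complex \<Rightarrow> bool" where
  "branch_law h U X \<eta> \<beta> \<longleftrightarrow> (\<forall>s\<in>U. fwd h X s + bwd h X s = \<eta> * X s + \<beta>)"

definition divided_diff ::
  "complex \<Rightarrow> complex set \<Rightarrow> (complex \<Rightarrow> complex) \<Rightarrow> complex poly \<Rightarrow> complex poly" where
  "divided_diff h U X p = (THE q. \<forall>s\<in>U. poly q (X s) =
     (poly p (fwd h X s) - poly p (bwd h X s)) / (fwd h X s - bwd h X s))"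

definition average ::
  "complex \<Rightarrow> complex set \<Rightarrow> (complex \<Rightarrow> complex) \<Rightarrow> complex poly \<Rightarrow> complex poly" where
  "average h U X p = (THE q. \<forall>s\<in>U. poly q (X s) =
     (poly p (fwd h X s) + poly p (bwd h X s)) / 2)"

text \<open>
  The continuous dual of the polynomials (inductive limit topology) is the full algebraic dual.
\<close>

definition poly_dual :: "(complex poly \<Rightarrow> complex) set" where
  "poly_dual = {u. Vector_Spaces.linear smult (*) u}"

definition mult_functional ::
  "complex poly \<Rightarrow> (complex poly \<Rightarrow> complex) \<Rightarrow> complex poly \<Rightarrow> complex" where
  "mult_functional p0 u = (\<lambda>p. u (p0 * p))"

definition dual_divided_diff ::
  "complex \<Rightarrow> complex set \<Rightarrow> (complex \<Rightarrow> complex) \<Rightarrow>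
     (complex poly \<Rightarrow> complex) \<Rightarrow> complex poly \<Rightarrow> complex" where
  "dual_divided_diff h U X u = (\<lambda>p. - u (divided_diff h U X p))"

definition dual_average ::
  "complex \<Rightarrow> complex set \<Rightarrow> (complex \<Rightarrow> complex) \<Rightarrow>
     (complex poly \<Rightarrow> complex) \<Rightarrow> complex poly \<Rightarrow> complex" where
  "dual_average h U X u = (\<lambda>p. u (average h U X p))"

text \<open>A family indexed by \<open>I\<close> is a sequence of which only the members with index in \<open>I\<close> matter.\<close>

definition orthogonal_family ::
  "(complex poly \<Rightarrow> complex) \<Rightarrow> nat set \<Rightarrow> (nat \<Rightarrow> complex poly) \<Rightarrow> bool" where
  "orthogonal_family u I P \<longleftrightarrow> (\<forall>n\<in>I. degree (P n) = n) \<and>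
     (\<forall>m\<in>I. \<forall>n\<in>I. m < n \<longrightarrow> u (P n * P m) = 0) \<and> (\<forall>n\<in>I. u ((P n)\<^sup>2) \<noteq> 0)"

definition monic_orthogonal_family ::
  "(complex poly \<Rightarrow> complex) \<Rightarrow> nat set \<Rightarrow> (nat \<Rightarrow> complex poly) \<Rightarrow> bool" where
  "monic_orthogonal_family u I P \<longleftrightarrow>
     orthogonal_family u I P \<and> (\<forall>n\<in>I. lead_coeff (P n) = 1)"

text \<open>The conditional is the convention \<open>P\<^sub>-\<^sub>1 = 0\<close>, so \<open>C 0\<close> is never used.\<close>

definition three_term_recurrence ::
  "(nat \<Rightarrow> complex) \<Rightarrow> (nat \<Rightarrow> complex) \<Rightarrow> nat set \<Rightarrow> (nat \<Rightarrow> complex poly) \<Rightarrow> bool" where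
  "three_term_recurrence B C K P \<longleftrightarrow> P 0 = 1 \<and>
     (\<forall>n\<in>K. P (n + 1) =
        [:- B n, 1:] * P n - (if n = 0 then 0 else smult (C n) (P (n - 1))))"

end

theory Submission
  imports Defs
begin

text \<open>
  Let \<open>L p = \<phi> D\<^sup>2 p + \<psi> S D p\<close>. The functional equation makes \<open>L\<close> symmetric with respect to \<open>\<langle>u, pq\<rangle>\<close>, and
  \<open>L\<close> is triangular on the powers of the variable with diagonal \<open>n d\<^bsub>n-1\<^esub>\<close>. Hence a monic orthogonal family consists of
  eigenpolynomials of \<open>L\<close>; conversely, as the eigenvalues with indices \<open>m < n\<close> differ by \<open>(n - m) d\<^bsub>n+m-1\<^esub>\<close>,
  monic eigenpolynomials exist and are mutually orthogonal when the \<open>d\<^sub>j\<close> do not vanish. Everything then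
  rests on the norms. Summation by parts gives \<open>\<langle>u, q L p\<rangle> = - \<langle>u', (Dq)(Dp)\<rangle>\<close> for a functional \<open>u'\<close> that
  satisfies an equation of the same type, with \<open>d'\<^sub>n = d\<^bsub>n+2\<^esub>\<close>, and \<open>D\<close> maps eigenpolynomials of \<open>L\<close> to
  eigenpolynomials of \<open>L'\<close>. Induction on \<open>n\<close> over all such functionals reduces the ratio of consecutive norms,
  and likewise the second coefficient of the eigenpolynomials, to the case \<open>n = 0\<close>.
\<close>

section \<open>Divided-difference and averaging operators on a quadratic lattice\<close>

locale quadratic_lattice =
  fixes a t :: "'a::field_char_0"
begin

text \<open>
  On the branch \<open>Y + Z = 2X + a/2\<close> one has \<open>Y, Z = X + a/4 \<plusminus> \<delta>\<close> with \<open>\<delta>\<^sup>2 = aX + t\<close>, where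
  \<open>t = (b\<^sup>2 - 4ac)/4\<close>. Writing \<open>p(Y) = (av p)(X) + \<delta> (dd p)(X)\<close>, multiplication of \<open>p\<close> by the
  variable gives the recursion below, so the operators are defined without reference to \<open>X\<close>.
\<close>

definition step_pair :: "'a poly \<Rightarrow> 'a poly \<times> 'a poly" where
  "step_pair p = fold_coeffs
     (\<lambda>c (d, s). ([:a/4, 1:] * d + s, [:c:] + [:t, a:] * d + [:a/4, 1:] * s)) p (0, 0)"

definition dd :: "'a poly \<Rightarrow> 'a poly" where "dd p = fst (step_pair p)"
definition av :: "'a poly \<Rightarrow> 'a poly" where "av p = snd (step_pair p)"

lemma step_pair_pCons:
  "step_pair (pCons c p) = ([:a/4, 1:] * dd p + av p, [:c:] + [:t, a:] * dd p + [:a/4, 1:] * av p)"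
proof (cases "p = 0 \<and> c = 0")
  case False
  then show ?thesis
    by (auto simp: step_pair_def dd_def av_def case_prod_beta)
qed (simp add: step_pair_def dd_def av_def)

lemma dd_0 [simp]: "dd 0 = 0" and av_0 [simp]: "av 0 = 0"
  by (simp_all add: dd_def av_def step_pair_def)

lemma dd_pCons: "dd (pCons c p) = [:a/4, 1:] * dd p + av p"
  and av_pCons: "av (pCons c p) = [:c:] + [:t, a:] * dd p + [:a/4, 1:] * av p"
  by (simp_all only: dd_def av_def step_pair_pCons fst_conv snd_conv)

lemma dd_1 [simp]: "dd 1 = 0" and av_1 [simp]: "av 1 = 1"
  by (simp_all add: one_pCons dd_pCons av_pCons)

lemma dd_av_add: "dd (p + q) = dd p + dd q \<and> av (p + q) = av p + av q"
proof (induction p q rule: poly_induct2)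
  case (pCons c p d q)
  have c: "[:c + d:] = [:c:] + [:d:]" by simp
  show ?case
    unfolding add_pCons dd_pCons av_pCons conjunct1[OF pCons.IH] conjunct2[OF pCons.IH]
    unfolding c by algebra
qed simp

lemma dd_add: "dd (p + q) = dd p + dd q" and av_add: "av (p + q) = av p + av q"
  using dd_av_add by blast+

lemma dd_av_smult: "dd (smult k p) = smult k (dd p) \<and> av (smult k p) = smult k (av p)"
proof (induction p)
  case (pCons c p)
  then show ?case
    by (simp add: dd_pCons av_pCons smult_add_right)
qed simp

lemma dd_smult: "dd (smult k p) = smult k (dd p)" and av_smult: "av (smult k p) = smult k (av p)"
  using dd_av_smult by blast+

lemma dd_diff: "dd (p - q) = dd p - dd q" and av_diff: "av (p - q) = av p - av q"
  using dd_add[of "p - q" q] av_add[of "p - q" q] by simp_all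

text \<open>These are the two parts of the product of \<open>av p + \<delta> dd p\<close> and
  \<open>av q + \<delta> dd q\<close> once \<delta>^2 = aX + t is inserted. They are proved jointly,
  as each recursion involves both operators.\<close>

lemma dd_av_mult:
  "dd (p * q) = dd p * av q + av p * dd q \<and> av (p * q) = [:t, a:] * dd p * dd q + av p * av q"
proof (induction p)
  case (pCons c p)
  have eq: "pCons c p * q = smult c q + pCons 0 (p * q)" by simp
  have c: "smult c r = [:c:] * r" for r by simp
  show ?case
    unfolding eq dd_add av_add dd_smult av_smult dd_pCons av_pCons conjunct1[OF pCons.IH]
      conjunct2[OF pCons.IH] unfolding c pCons_0_0 add_0 by algebra
qed simp

lemma dd_mult: "dd (p * q) = dd p * av q + av p * dd q"
  and av_mult: "av (p * q) = [:t, a:] * dd p * dd q + av p * av q"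
  using dd_av_mult by blast+

lemma dd_const: "dd [:k:] = 0" and av_const: "av [:k:] = [:k:]"
  by (simp_all add: dd_pCons av_pCons)

lemma dd_linear: "dd [:c0, c1:] = [:c1:]"
  and av_linear: "av [:c0, c1:] = [:c0 + c1 * a / 4, c1:]"
  by (simp_all add: dd_pCons av_pCons algebra_simps)

lemma dd_quadratic: "dd [:c0, c1, c2:] = [:c1 + c2 * a / 2, 2 * c2:]"
  and av_quadratic:
    "av [:c0, c1, c2:] = [:c0 + c1 * a / 4 + c2 * (t + a\<^sup>2 / 16), c1 + c2 * (3 / 2 * a), c2:]"
  by (simp_all add: dd_pCons av_pCons algebra_simps power2_eq_square)

text \<open>A half step forward or backward changes \<delta> by plus or minus a/2. Composing the
  half sum and the half difference of the two shifts in both orders gives the relations; the second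
  also uses that opposite shifts cancel.\<close>

lemma dd_av_commute:
  "dd (av p) = av (dd p) + [:a/2:] * dd (dd p) \<and>
   av (av p) = p + [:t, a:] * dd (dd p) + [:a/2:] * av (dd p)"
proof (induction p)
  case (pCons c p)
  \<comment> \<open>Naming the coefficient polynomials and their images under both operators turns
    the claim into a commutative-ring identity.\<close>
  define A U H K where "A = [:a/4, 1:]" and "U = [:t, a:]" and "H = [:a/4:]" and "K = [:c:]"
  have half: "[:a/2:] = 2 * H" and X: "pCons c p = K + (A - H) * p"
    by (simp_all add: H_def K_def A_def numeral_poly)
  have dd_p: "dd (pCons c p) = A * dd p + av p" and av_p: "av (pCons c p) = K + U * dd p + A * av p"
    by (simp_all only: dd_pCons av_pCons A_def U_def K_def)
  have dd_coeffs: "dd A = 1" "dd U = 4 * H" "dd K = 0"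
    and av_coeffs: "av A = A + H" "av U = U + 4 * H * H" "av K = K"
    by (simp_all add: A_def U_def H_def K_def dd_pCons av_pCons numeral_poly)
  show ?case
    unfolding dd_p av_p dd_add av_add dd_mult av_mult U_def[symmetric] dd_coeffs av_coeffs
      conjunct1[OF pCons.IH] conjunct2[OF pCons.IH] half
    unfolding X by algebra
qed simp

lemma dd_av: "dd (av p) = av (dd p) + [:a/2:] * dd (dd p)"
  and av_av: "av (av p) = p + [:t, a:] * dd (dd p) + [:a/2:] * av (dd p)"
  using dd_av_commute by blast+

section \<open>Leading and subleading coefficients of \<open>dd p\<close> and
  \<open>av p\<close>\<close>

lemma coeff_dd_av_aux:
  "degree p \<le> n \<Longrightarrow> (\<forall>k\<ge>n. coeff (dd p) k = 0) \<and> (\<forall>k>n. coeff (av p) k = 0) \<and> coeff (av p) n = coeff p n"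
proof (induction n arbitrary: p)
  case 0
  then obtain c where "p = [:c:]" by (auto elim: degree_eq_zeroE)
  then show ?case by (auto simp: dd_pCons av_pCons coeff_pCons split: nat.splits)
next
  case (Suc n)
  obtain c q where p: "p = pCons c q" by (cases p)
  with Suc.prems have "degree q \<le> n" by (auto split: if_splits)
  from Suc.IH[OF this] show ?case
    by (auto simp: p dd_pCons av_pCons coeff_pCons split: nat.splits)
qed

lemma coeff_dd_eq_0: "degree p \<le> n \<Longrightarrow> k \<ge> n \<Longrightarrow> coeff (dd p) k = 0"
  and coeff_av_eq_0: "degree p \<le> n \<Longrightarrow> k > n \<Longrightarrow> coeff (av p) k = 0"
  and coeff_av: "degree p \<le> n \<Longrightarrow> coeff (av p) n = coeff p n"
  using coeff_dd_av_aux by blast+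

lemma degree_dd_le: "degree p \<le> Suc n \<Longrightarrow> degree (dd p) \<le> n"
  by (rule degree_le) (auto intro: coeff_dd_eq_0)

lemma degree_av_le: "degree p \<le> n \<Longrightarrow> degree (av p) \<le> n"
  by (rule degree_le) (auto intro: coeff_av_eq_0)

lemma coeff_dd: "degree p \<le> Suc n \<Longrightarrow> coeff (dd p) n = of_nat (Suc n) * coeff p (Suc n)"
proof (induction n arbitrary: p)
  case (0 p)
  obtain c q where p: "p = pCons c q" by (cases p)
  with 0 have "degree q \<le> 0" by (auto split: if_splits)
  then show ?case
    using coeff_dd_eq_0[of q 0] coeff_av[of q 0] by (simp add: p dd_pCons)
next
  case (Suc n p)
  obtain c q where p: "p = pCons c q" by (cases p)
  with Suc.prems have q: "degree q \<le> Suc n" by (auto split: if_splits)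
  from Suc.IH[OF q] coeff_dd_eq_0[OF q, of "Suc n"] coeff_av[OF q]
  show ?case by (simp add: p dd_pCons algebra_simps)
qed

text \<open>The step from n to n + 1 adds a/4 + a(n + 1) to the constant: a/4 from the factor X +
  a/4, and a(n + 1) from the leading coefficient of \<open>dd\<close> times that of
  \<open>[:t, a:]\<close>. The quadratic factor sums these increments.\<close>

lemma coeff_av_subleading: "degree p \<le> Suc n \<Longrightarrow>
   coeff (av p) n = coeff p n + a * of_nat ((n + 1) * (2 * n + 1)) / 4 * coeff p (Suc n)"
proof (induction n arbitrary: p)
  case (0 p)
  obtain c q where p: "p = pCons c q" by (cases p)
  with 0 have "degree q \<le> 0" by (auto split: if_splits)
  then show ?case
    using coeff_dd_eq_0[of q 0] coeff_av[of q 0] by (simp add: p av_pCons)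
next
  case (Suc n p)
  obtain c q where p: "p = pCons c q" by (cases p)
  with Suc.prems have q: "degree q \<le> Suc n" by (auto split: if_splits)
  from Suc.IH[OF q] coeff_dd_eq_0[OF q, of "Suc n"] coeff_av[OF q] coeff_dd[OF q]
  show ?case by (simp add: p av_pCons) (simp add: field_simps)
qed

lemma coeff_dd_subleading: "degree p \<le> Suc (Suc n) \<Longrightarrow>
   coeff (dd p) n = of_nat (n + 1) * coeff p (Suc n)
     + a * of_nat ((n + 2) * (n + 1) * (2 * n + 3)) / 12 * coeff p (Suc (Suc n))"
proof (induction n arbitrary: p)
  case (0 p)
  obtain c q where p: "p = pCons c q" by (cases p)
  with 0 have "degree q \<le> Suc 0" by (auto split: if_splits)
  then show ?case
    using coeff_dd[of q 0] coeff_av_subleading[of q 0] by (simp add: p dd_pCons field_simps)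
next
  case (Suc n p)
  obtain c q where p: "p = pCons c q" by (cases p)
  with Suc.prems have q: "degree q \<le> Suc (Suc n)" by (auto split: if_splits)
  from Suc.IH[OF q] coeff_av_subleading[OF q] coeff_dd[OF q]
  show ?case by (simp add: p dd_pCons) (simp add: field_simps)
qed

end

section \<open>Linear functionals and triangular operators on polynomials\<close>

lemma poly_functional_simps:
  fixes u :: "'a::field poly \<Rightarrow> 'a"
  assumes "Vector_Spaces.linear smult (*) u"
  shows "u (p + q) = u p + u q" "u (p - q) = u p - u q" "u (smult k p) = k * u p"
    "u (- p) = - u p" "u 0 = 0"
proof -
  interpret u: Vector_Spaces.linear smult "(*)" u by (fact assms)
  show "u (p + q) = u p + u q" "u (p - q) = u p - u q" "u (smult k p) = k * u p"
    "u (- p) = - u p" "u 0 = 0"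
    by (rule u.add u.diff u.scale u.neg u.zero)+
qed

lemma poly_functionalI:
  fixes u :: "'a::field poly \<Rightarrow> 'a"
  assumes "\<And>p q. u (p + q) = u p + u q" "\<And>k p. u (smult k p) = k * u p"
  shows "Vector_Spaces.linear smult (*) u"
  by unfold_locales (simp_all add: assms algebra_simps smult_add_left smult_add_right)

text \<open>A monomial scaled by the diagonal entry removes the top coefficient, and induction
  handles the rest. The diagonal is constrained only below \<open>n\<close>, so that an operator
  with a zero entry at \<open>n\<close> is covered.\<close>

lemma triangular_surj:
  fixes T :: "'a::field poly \<Rightarrow> 'a poly"
  assumes add: "\<And>p q. T (p + q) = T p + T q"
    and diag: "\<And>p n. degree p \<le> n \<Longrightarrow> degree (T p) \<le> n \<and> coeff (T p) n = w n * coeff p n"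
    and w: "\<And>m. m < n \<Longrightarrow> w m \<noteq> 0"
    and r: "\<And>k. k \<ge> n \<Longrightarrow> coeff r k = 0"
  shows "\<exists>q. (\<forall>k\<ge>n. coeff q k = 0) \<and> T q = r"
  using w r
proof (induction n arbitrary: r)
  case 0
  have "T 0 = 0" using add[of 0 0] by (metis add.right_neutral add_left_cancel)
  moreover have "r = 0" using 0 by (simp add: poly_eq_iff)
  ultimately show ?case by (intro exI[of _ 0]) simp
next
  case (Suc n)
  define q0 where "q0 = monom (coeff r n / w n) n"
  have q0: "degree q0 \<le> n" by (simp add: q0_def degree_monom_le)
  have "coeff (r - T q0) k = 0" if "k \<ge> n" for k
  proof (cases "k = n")
    case True
    then show ?thesis using diag[OF q0] Suc.prems(1)[of n] by (simp add: q0_def)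
  next
    case False
    then show ?thesis using diag[OF q0] Suc.prems(2)[of k] that
      by (simp add: coeff_eq_0)
  qed
  with Suc obtain q where q: "\<forall>k\<ge>n. coeff q k = 0" "T q = r - T q0"
    by (metis less_Suc_eq)
  have "coeff (q0 + q) k = 0" if "k \<ge> Suc n" for k
    using that q by (simp add: q0_def)
  then show ?case
    using q by (intro exI[of _ "q0 + q"]) (simp add: add)
qed

lemma degree_le_2E:
  assumes "degree p \<le> 2"
  obtains c0 c1 c2 where "p = [:c0, c1, c2:]"
proof
  show "p = [:coeff p 0, coeff p 1, coeff p 2:]"
    using assms by (intro poly_eqI)
      (auto simp: coeff_pCons coeff_eq_0 eval_nat_numeral split: nat.splits)
qed

lemma degree_le_1E:
  assumes "degree p \<le> 1"
  obtains c0 c1 where "p = [:c0, c1:]"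
proof
  show "p = [:coeff p 0, coeff p 1:]"
    using assms by (intro poly_eqI) (auto simp: coeff_pCons coeff_eq_0 split: nat.splits)
qed

section \<open>The operator \<open>lop\<close>, its symmetry, the shift and the
  eigenpolynomials\<close>

context quadratic_lattice
begin

lemma dd_U: "dd [:t, a:] = 2 * [:a/2:]" and av_U: "av [:t, a:] = [:t, a:] + [:a/2:] * [:a/2:]"
  by (simp_all add: dd_pCons av_pCons numeral_poly)

definition lop :: "'a poly \<Rightarrow> 'a poly \<Rightarrow> 'a poly \<Rightarrow> 'a poly" where
  "lop \<phi> \<psi> p = \<phi> * dd (dd p) + \<psi> * av (dd p)"

text \<open>The equation between the transposes, evaluated at a test polynomial \<open>f\<close>
  with both sides collected inside \<open>u\<close>.\<close>

definition solves :: "('a poly \<Rightarrow> 'a) \<Rightarrow> 'a poly \<Rightarrow> 'a poly \<Rightarrow> bool" where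
  "solves u \<phi> \<psi> \<longleftrightarrow> Vector_Spaces.linear smult (*) u \<and> (\<forall>f. u (\<phi> * dd f + \<psi> * av f) = 0)"

text \<open>
  In terms of \<open>A = \<phi> + \<delta>\<psi>\<close> as a function of the lattice parameter \<open>s\<close>, the shifted pair is
  determined by \<open>\<phi>' + \<delta>\<psi>' = A(s + 1/2)\<close>.
\<close>

definition shift_phi :: "'a poly \<Rightarrow> 'a poly \<Rightarrow> 'a poly" where
  "shift_phi \<phi> \<psi> = av \<phi> + [:t, a:] * dd \<psi> + [:a/2:] * av \<psi>"

definition shift_psi :: "'a poly \<Rightarrow> 'a poly \<Rightarrow> 'a poly" where
  "shift_psi \<phi> \<psi> = dd \<phi> + av \<psi> + [:a/2:] * dd \<psi>"

text \<open>\<open>u\<close> is applied to the part free of \<delta> in the product of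
  \<open>\<phi> + \<delta>\<psi>\<close> with \<open>av g + \<delta> dd g\<close>, the value of
  \<open>g\<close> after a half step.\<close>

definition shift_functional :: "('a poly \<Rightarrow> 'a) \<Rightarrow> 'a poly \<Rightarrow> 'a poly \<Rightarrow> 'a poly \<Rightarrow> 'a" where
  "shift_functional u \<phi> \<psi> g = u (\<phi> * av g + \<psi> * [:t, a:] * dd g)"

lemma lop_add: "lop \<phi> \<psi> (p + q) = lop \<phi> \<psi> p + lop \<phi> \<psi> q"
  by (simp add: lop_def dd_add av_add algebra_simps)

lemma lop_smult: "lop \<phi> \<psi> (smult k p) = smult k (lop \<phi> \<psi> p)"
  by (simp add: lop_def dd_smult av_smult smult_add_right)

lemma lop_1 [simp]: "lop \<phi> \<psi> 1 = 0"
  by (simp add: lop_def)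

lemmas operator_simps = dd_add av_add dd_diff av_diff dd_mult av_mult dd_av av_av dd_U av_U
  dd_const av_const

text \<open>The polynomial \<open>av q * dd p - av p * dd q\<close> is the lattice Wronskian
  (p(Y)q(Z) - p(Z)q(Y)) / (2\<delta>). Taking it as test polynomial in \<open>solves\<close> makes
  \<open>lop\<close> symmetric.\<close>

lemma lop_commutator:
  "q * lop \<phi> \<psi> p - p * lop \<phi> \<psi> q =
     \<phi> * dd (av q * dd p - av p * dd q) + \<psi> * av (av q * dd p - av p * dd q)"
  unfolding lop_def operator_simps by algebra

text \<open>Summation by parts: \<open>u\<close> annihilates the right-hand side.\<close>

lemma lop_shift_product:
  "q * lop \<phi> \<psi> p + (\<phi> * av (dd q * dd p) + \<psi> * [:t, a:] * dd (dd q * dd p)) =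
     \<phi> * dd (av q * dd p - [:a/2:] * (dd q * dd p)) +
     \<psi> * av (av q * dd p - [:a/2:] * (dd q * dd p))"
  unfolding lop_def operator_simps by algebra

text \<open>When \<psi> has degree at most 1, \<open>dd \<psi>\<close> is constant, so
  \<open>dd\<close> turns an eigenpolynomial of \<open>lop\<close> into one for the shifted
  pair.\<close>

lemma lop_dd: "dd (lop \<phi> \<psi> p) = lop (shift_phi \<phi> \<psi>) (shift_psi \<phi> \<psi>) (dd p) + dd \<psi> * dd p"
  unfolding lop_def shift_phi_def shift_psi_def operator_simps by algebra

text \<open>After a half step, \<open>(\<phi> + \<delta>\<psi>) g\<close> splits into a part M free
  of \<delta> and \<delta> times \<open>G\<close>; \<open>F\<close> is M - (a/2)G. The equation of
  the shifted functional at \<open>g\<close> thereby becomes that of \<open>u\<close> at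
  \<open>F\<close>.\<close>

lemma shift_solves_identity:
  assumes "F = av (\<phi> * g) + [:t, a:] * dd (\<psi> * g) + [:a/2:] * av (\<psi> * g) - [:a/2:] * G"
    and "G = shift_phi \<phi> \<psi> * dd g + shift_psi \<phi> \<psi> * av g"
  shows "\<phi> * av G + \<psi> * [:t, a:] * dd G = \<phi> * dd F + \<psi> * av F"
  unfolding assms(1) operator_simps unfolding assms(2) shift_phi_def shift_psi_def operator_simps by algebra

lemma lop_symmetric:
  assumes "solves u \<phi> \<psi>"
  shows "u (q * lop \<phi> \<psi> p) = u (p * lop \<phi> \<psi> q)"
proof -
  have "u (q * lop \<phi> \<psi> p - p * lop \<phi> \<psi> q) = 0"
    using assms unfolding lop_commutator solves_def by blast
  then show ?thesis
    using assms by (simp add: solves_def poly_functional_simps)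
qed

lemma shift_functional_dd:
  assumes "solves u \<phi> \<psi>"
  shows "shift_functional u \<phi> \<psi> (dd q * dd p) = - u (q * lop \<phi> \<psi> p)"
proof -
  have "u (q * lop \<phi> \<psi> p + (\<phi> * av (dd q * dd p) + \<psi> * [:t, a:] * dd (dd q * dd p))) = 0"
    using assms unfolding lop_shift_product solves_def by blast
  moreover have "Vector_Spaces.linear smult (*) u" using assms by (simp add: solves_def)
  ultimately show ?thesis
    unfolding shift_functional_def by (metis add.inverse_unique add.commute poly_functional_simps(1))
qed

lemma shift_solves:
  assumes "solves u \<phi> \<psi>"
  shows "solves (shift_functional u \<phi> \<psi>) (shift_phi \<phi> \<psi>) (shift_psi \<phi> \<psi>)"
  unfolding solves_def
proof
  have u: "Vector_Spaces.linear smult (*) u" using assms by (simp add: solves_def)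
  have add: "\<phi> * av (p + q) + \<psi> * [:t, a:] * dd (p + q) =
      (\<phi> * av p + \<psi> * [:t, a:] * dd p) + (\<phi> * av q + \<psi> * [:t, a:] * dd q)" for p q
    unfolding dd_add av_add by algebra
  have scale: "\<phi> * av (smult k p) + \<psi> * [:t, a:] * dd (smult k p) =
      smult k (\<phi> * av p + \<psi> * [:t, a:] * dd p)" for k p
    unfolding dd_smult av_smult mult_smult_right smult_add_right ..
  show "Vector_Spaces.linear smult (*) (shift_functional u \<phi> \<psi>)"
    by (rule poly_functionalI)
      (simp_all only: shift_functional_def add scale poly_functional_simps[OF u])
  show "\<forall>f. shift_functional u \<phi> \<psi> (shift_phi \<phi> \<psi> * dd f + shift_psi \<phi> \<psi> * av f) = 0"
    unfolding shift_functional_def shift_solves_identity[OF refl refl, of \<phi> \<psi>]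
    using assms by (simp add: solves_def)
qed

text \<open>The argument ranges over the field, so that n - 1 at n = 0 and shifts of the index need
  no truncated subtraction.\<close>

definition dcoef :: "'a poly \<Rightarrow> 'a poly \<Rightarrow> 'a \<Rightarrow> 'a" where
  "dcoef \<phi> \<psi> x = coeff \<phi> 2 * x + coeff \<psi> 1"

definition eigval :: "'a poly \<Rightarrow> 'a poly \<Rightarrow> nat \<Rightarrow> 'a" where
  "eigval \<phi> \<psi> n = of_nat n * dcoef \<phi> \<psi> (of_nat n - 1)"

lemma eigval_diff: "eigval \<phi> \<psi> n - eigval \<phi> \<psi> m = (of_nat n - of_nat m) * dcoef \<phi> \<psi> (of_nat n + of_nat m - 1)"
  by (simp add: eigval_def dcoef_def algebra_simps)

lemma eigval_neq:
  assumes "m < n" "\<And>j. j \<le> 2 * n - 2 \<Longrightarrow> dcoef \<phi> \<psi> (of_nat j) \<noteq> 0"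
  shows "eigval \<phi> \<psi> m \<noteq> eigval \<phi> \<psi> n"
proof -
  have "of_nat n + of_nat m - 1 = (of_nat (n + m - 1) :: 'a)"
    using assms(1) by (simp add: of_nat_diff)
  moreover have "dcoef \<phi> \<psi> (of_nat (n + m - 1)) \<noteq> 0"
    using assms(1) by (intro assms(2)) simp
  ultimately have "eigval \<phi> \<psi> n - eigval \<phi> \<psi> m \<noteq> 0"
    unfolding eigval_diff using assms(1) by simp
  then show ?thesis by force
qed

lemma coeff_lop:
  assumes \<phi>: "degree \<phi> \<le> 2" and \<psi>: "degree \<psi> \<le> 1" and p: "degree p \<le> n"
  shows "degree (lop \<phi> \<psi> p) \<le> n \<and> coeff (lop \<phi> \<psi> p) n = eigval \<phi> \<psi> n * coeff p n"
proof -
  obtain f0 f1 f2 where f: "\<phi> = [:f0, f1, f2:]" using \<phi> by (rule degree_le_2E)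
  obtain g0 g1 where g: "\<psi> = [:g0, g1:]" using \<psi> by (rule degree_le_1E)
  consider "n = 0" | "n = 1" | m where "n = Suc (Suc m)"
    by (metis One_nat_def old.nat.exhaust)
  then show ?thesis
  proof cases
    case 1
    with p obtain c where "p = [:c:]" by (auto elim: degree_eq_zeroE)
    then show ?thesis by (simp add: lop_def dd_const eigval_def 1)
  next
    case 2
    with p have "degree p \<le> 1" by simp
    then obtain c0 c1 where "p = [:c0, c1:]" by (rule degree_le_1E)
    then show ?thesis
      by (simp add: lop_def dd_linear dd_const av_const eigval_def dcoef_def f g 2)
  next
    case 3
    have p1: "degree (dd p) \<le> Suc m" using p 3 by (auto intro: degree_dd_le)
    then have p2: "degree (dd (dd p)) \<le> m" and p3: "degree (av (dd p)) \<le> Suc m"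
      by (auto intro: degree_dd_le degree_av_le)
    have "degree (\<phi> * dd (dd p)) \<le> n" "degree (\<psi> * av (dd p)) \<le> n"
      using order.trans[OF degree_mult_le add_mono[OF \<phi> p2]]
        order.trans[OF degree_mult_le add_mono[OF \<psi> p3]] by (simp_all add: 3)
    moreover have "coeff (lop \<phi> \<psi> p) n = eigval \<phi> \<psi> n * coeff p n"
      using coeff_dd[OF p1] coeff_av[OF p1] coeff_dd[of p "Suc m"] p p2 p3
      by (simp add: lop_def 3 f g coeff_eq_0 eigval_def dcoef_def numeral_2_eq_2)
        (simp add: algebra_simps)
    ultimately show ?thesis by (simp add: lop_def degree_add_le)
  qed
qed

definition eigenpoly :: "'a poly \<Rightarrow> 'a poly \<Rightarrow> nat \<Rightarrow> 'a poly \<Rightarrow> bool" where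
  "eigenpoly \<phi> \<psi> n p \<longleftrightarrow> degree p = n \<and> coeff p n = 1 \<and> lop \<phi> \<psi> p = smult (eigval \<phi> \<psi> n) p"

text \<open>\<open>lop\<close> minus its eigenvalue sends the monomial of degree \<open>n\<close> to
  a polynomial of lower degree. A correction below degree \<open>n\<close> cancels this image,
  because the remaining diagonal entries are differences of distinct eigenvalues.\<close>

lemma eigenpoly_exists:
  assumes \<phi>: "degree \<phi> \<le> 2" and \<psi>: "degree \<psi> \<le> 1"
    and d: "\<And>j. j \<le> 2 * n - 2 \<Longrightarrow> dcoef \<phi> \<psi> (of_nat j) \<noteq> 0"
  shows "\<exists>p. eigenpoly \<phi> \<psi> n p"
proof -
  define T where "T p = lop \<phi> \<psi> p - smult (eigval \<phi> \<psi> n) p" for p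
  define w where "w m = eigval \<phi> \<psi> m - eigval \<phi> \<psi> n" for m
  have add: "T (p + q) = T p + T q" for p q
    by (simp add: T_def lop_add smult_add_right)
  have diag: "degree (T p) \<le> m \<and> coeff (T p) m = w m * coeff p m" if "degree p \<le> m" for p m
    using coeff_lop[OF \<phi> \<psi> that] that
    by (auto simp: T_def w_def algebra_simps intro!: degree_diff_le)
  have "coeff (- T (monom 1 n)) k = 0" if "k \<ge> n" for k
    using diag[of "monom 1 n" n] that
    by (cases "k = n") (auto simp: degree_monom_le w_def coeff_eq_0)
  moreover have "w m \<noteq> 0" if "m < n" for m
    using eigval_neq[OF that d] by (simp add: w_def)
  ultimately obtain q where q: "\<forall>k\<ge>n. coeff q k = 0" "T q = - T (monom 1 n)"
    using triangular_surj[of T w n, OF add diag] by blast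
  define p where "p = monom 1 n + q"
  have n: "coeff p n = 1" using q by (simp add: p_def)
  moreover have "degree p \<le> n" using q by (intro degree_le) (simp add: p_def)
  ultimately have "degree p = n" by (simp add: le_degree le_antisym)
  moreover have "T p = 0" using q by (simp add: p_def add)
  ultimately have "eigenpoly \<phi> \<psi> n p" using n by (simp add: eigenpoly_def T_def)
  then show ?thesis ..
qed

lemma dd_surj: "\<exists>p. dd p = q"
proof -
  \<comment> \<open>Multiplication by the variable compensates the degree lost under
    \<open>dd\<close>; the composite is triangular with diagonal n + 1.\<close>
  define T where "T p = dd (pCons 0 p)" for p
  have add: "T (p + q) = T p + T q" for p q
    using dd_add[of "pCons 0 p" "pCons 0 q"] by (simp add: T_def)
  have diag: "degree (T p) \<le> n \<and> coeff (T p) n = of_nat (Suc n) * coeff p n" if "degree p \<le> n" for p n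
  proof -
    have "degree (pCons 0 p) \<le> Suc n" using that by simp
    from coeff_dd[OF this] degree_dd_le[OF this] show ?thesis by (simp add: T_def)
  qed
  have "coeff q k = 0" if "k \<ge> Suc (degree q)" for k
    using that by (simp add: coeff_eq_0)
  moreover have "of_nat (Suc m) \<noteq> (0::'a)" for m
    by (rule of_nat_neq_0)
  ultimately obtain p where "T p = q"
    using triangular_surj[of T "\<lambda>n. of_nat (Suc n)" "Suc (degree q)" q, OF add diag] by blast
  then show ?thesis by (auto simp: T_def)
qed

end

section \<open>The shifted functional\<close>

context quadratic_lattice
begin

definition ecoef :: "'a poly \<Rightarrow> 'a poly \<Rightarrow> 'a \<Rightarrow> 'a" where
  "ecoef \<phi> \<psi> x = coeff \<phi> 1 * x + coeff \<psi> 0 + 1 / 2 * a * coeff \<psi> 1 * x\<^sup>2"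

definition phi_iter :: "'a poly \<Rightarrow> 'a poly \<Rightarrow> 'a \<Rightarrow> 'a poly" where
  "phi_iter \<phi> \<psi> x =
     [: poly \<phi> (1 / 4 * a * x\<^sup>2) + 1 / 2 * a * x * poly \<psi> (1 / 4 * a * x\<^sup>2) + x * t * dcoef \<phi> \<psi> x,
        coeff \<phi> 1 + 3 / 2 * a * x * dcoef \<phi> \<psi> x,
        coeff \<phi> 2 :]"

definition node :: "'a poly \<Rightarrow> 'a poly \<Rightarrow> 'a \<Rightarrow> 'a" where
  "node \<phi> \<psi> x = - (1 / 4) * a * x\<^sup>2 - ecoef \<phi> \<psi> x / dcoef \<phi> \<psi> (2 * x)"

text \<open>At n = 0 the general prefactor would contain \<open>dcoef \<phi> \<psi> (- 1)\<close>
  divided by itself, which is 0 instead of 1 when that value vanishes; hence the separate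
  value.\<close>

definition norm_ratio :: "'a poly \<Rightarrow> 'a poly \<Rightarrow> nat \<Rightarrow> 'a" where
  "norm_ratio \<phi> \<psi> n = (if n = 0 then - (1 / dcoef \<phi> \<psi> 1)
     else - ((of_nat n + 1) * dcoef \<phi> \<psi> (of_nat n - 1) /
            (dcoef \<phi> \<psi> (2 * of_nat n - 1) * dcoef \<phi> \<psi> (2 * of_nat n + 1)))) *
     poly (phi_iter \<phi> \<psi> (of_nat n)) (node \<phi> \<psi> (of_nat n))"

section \<open>Effect of the shift on coefficients, nodes and norm ratios\<close>

lemma shift_phi_eq:
  "shift_phi [:f0, f1, f2:] [:g0, g1:] =
     [: f0 + f1 * a / 4 + f2 * (t + a\<^sup>2 / 16) + t * g1 + a / 2 * (g0 + g1 * a / 4),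
        f1 + 3 / 2 * a * (f2 + g1), f2 :]"
  by (simp add: shift_phi_def av_quadratic dd_linear av_linear) (simp add: field_simps)

lemma shift_psi_eq:
  "shift_psi [:f0, f1, f2:] [:g0, g1:] = [:f1 + g0 + a * f2 / 2 + 3 / 4 * a * g1, 2 * f2 + g1:]"
  by (simp add: shift_psi_def dd_quadratic dd_linear av_linear algebra_simps)

context
  fixes \<phi> \<psi> :: "'a poly"
  assumes \<phi>: "degree \<phi> \<le> 2" and \<psi>: "degree \<psi> \<le> 1"
begin

lemma degree_shift_phi: "degree (shift_phi \<phi> \<psi>) \<le> 2"
  and degree_shift_psi: "degree (shift_psi \<phi> \<psi>) \<le> 1"
  by (rule degree_le_2E[OF \<phi>], rule degree_le_1E[OF \<psi>], simp add: shift_phi_eq shift_psi_eq)+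

lemma dcoef_shift: "dcoef (shift_phi \<phi> \<psi>) (shift_psi \<phi> \<psi>) x = dcoef \<phi> \<psi> (x + 2)"
  by (rule degree_le_2E[OF \<phi>], rule degree_le_1E[OF \<psi>])
    (simp add: shift_phi_eq shift_psi_eq dcoef_def numeral_2_eq_2 algebra_simps)

lemma ecoef_shift: "ecoef (shift_phi \<phi> \<psi>) (shift_psi \<phi> \<psi>) x =
    ecoef \<phi> \<psi> (x + 1) + 1 / 4 * a * (2 * x + 1) * dcoef \<phi> \<psi> (2 * x + 2)"
  by (rule degree_le_2E[OF \<phi>], rule degree_le_1E[OF \<psi>])
    (simp add: shift_phi_eq shift_psi_eq dcoef_def ecoef_def numeral_2_eq_2, simp add: field_simps)

text \<open>At x = 0 the polynomial is \<phi> itself, so its value at x = n is the first component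
  of the pair after n shifts.\<close>

lemma phi_iter_shift:
  "phi_iter (shift_phi \<phi> \<psi>) (shift_psi \<phi> \<psi>) x = phi_iter \<phi> \<psi> (x + 1)"
proof -
  obtain f0 f1 f2 where f: "\<phi> = [:f0, f1, f2:]" using \<phi> by (rule degree_le_2E)
  obtain g0 g1 where g: "\<psi> = [:g0, g1:]" using \<psi> by (rule degree_le_1E)
  show ?thesis
    unfolding phi_iter_def f g shift_phi_eq shift_psi_eq dcoef_def pCons_eq_iff
    by (simp add: numeral_2_eq_2) (simp add: field_simps power2_eq_square)
qed

text \<open>The extra term in \<open>ecoef_shift\<close>, divided by
  \<open>dcoef \<phi> \<psi> (2 * x + 2)\<close>, is a(2x + 1)/4 and completes a x^2/4 to a(x +
  1)^2/4.\<close>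

lemma node_shift:
  assumes "dcoef \<phi> \<psi> (2 * x + 2) \<noteq> 0"
  shows "node (shift_phi \<phi> \<psi>) (shift_psi \<phi> \<psi>) x = node \<phi> \<psi> (x + 1)"
proof -
  have "2 * (x + 1) = 2 * x + 2" by simp
  then show ?thesis
    using assms by (simp add: node_def ecoef_shift dcoef_shift)
      (simp add: field_simps power2_eq_square)
qed

text \<open>The first factor undoes a change of normalisation: for an eigenpolynomial
  \<open>p\<close> of degree n + 1, passing to \<open>dd p\<close> divided by n + 1 and to the
  shifted functional multiplies the squared norm by -d_n/(n + 1).\<close>

lemma norm_ratio_shift:
  assumes d: "\<And>j. j \<le> 2 * n + 3 \<Longrightarrow> dcoef \<phi> \<psi> (of_nat j) \<noteq> 0"
  shows "norm_ratio \<phi> \<psi> (Suc n) =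
    (of_nat n + 2) * dcoef \<phi> \<psi> (of_nat n) / ((of_nat n + 1) * dcoef \<phi> \<psi> (of_nat n + 1)) *
    norm_ratio (shift_phi \<phi> \<psi>) (shift_psi \<phi> \<psi>) n"
proof -
  have "dcoef \<phi> \<psi> (2 * of_nat n + 2) \<noteq> 0" using d[of "2 * n + 2"] by (simp add: add.commute)
  note node = node_shift[OF this]
  have d1: "dcoef \<phi> \<psi> (of_nat n + 1) \<noteq> 0"
    using d[of "n + 1"] by (simp add: add.commute)
  have n1: "of_nat n + 1 \<noteq> (0::'a)" using of_nat_neq_0[of n] by (simp add: add.commute)
  have eqs: "2 * of_nat (Suc n) - 1 = 2 * of_nat n + (1::'a)" "2 * of_nat (Suc n) + 1 = 2 * of_nat n + (3::'a)"
    "of_nat (Suc n) - 1 = (of_nat n::'a)" "of_nat (Suc n) + 1 = of_nat n + (2::'a)"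
    "of_nat (Suc n) = of_nat n + (1::'a)"
    "2 * of_nat n - 1 + 2 = 2 * of_nat n + (1::'a)" "2 * of_nat n + 1 + 2 = 2 * of_nat n + (3::'a)"
    "of_nat n - 1 + 2 = of_nat n + (1::'a)" "1 + 2 = (3::'a)"
    by (simp_all add: algebra_simps)
  show ?thesis
  proof (cases "n = 0")
    case True
    then show ?thesis using d1 node
      by (simp add: norm_ratio_def dcoef_shift phi_iter_shift)
  next
    case False
    then show ?thesis using d1 n1
      unfolding norm_ratio_def node dcoef_shift phi_iter_shift eqs
      by (simp add: add.commute)
  qed
qed

text \<open>By \<open>lop_dd\<close> the eigenvalue drops by \<open>coeff \<psi> 1\<close> to n
  d_{n+1}, the eigenvalue of index n for the shifted pair. Division by n + 1 restores the leading
  coefficient 1.\<close>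

lemma eigenpoly_shift:
  assumes p: "eigenpoly \<phi> \<psi> (Suc n) p"
  shows "eigenpoly (shift_phi \<phi> \<psi>) (shift_psi \<phi> \<psi>) n (smult (1 / of_nat (Suc n)) (dd p))"
proof -
  have n1: "of_nat (Suc n) \<noteq> (0::'a)" by (rule of_nat_neq_0)
  have deg: "degree p \<le> Suc n" and p1: "coeff p (Suc n) = 1"
    and lop: "lop \<phi> \<psi> p = smult (eigval \<phi> \<psi> (Suc n)) p"
    using p by (simp_all add: eigenpoly_def)
  have "dd (lop \<phi> \<psi> p) = lop (shift_phi \<phi> \<psi>) (shift_psi \<phi> \<psi>) (dd p) + smult (coeff \<psi> 1) (dd p)"
    unfolding lop_dd by (rule degree_le_1E[OF \<psi>]) (simp add: dd_linear)
  then have "lop (shift_phi \<phi> \<psi>) (shift_psi \<phi> \<psi>) (dd p) =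
      smult (eigval \<phi> \<psi> (Suc n) - coeff \<psi> 1) (dd p)"
    by (simp add: lop dd_smult smult_diff_left)
  moreover have "eigval \<phi> \<psi> (Suc n) - coeff \<psi> 1 = eigval (shift_phi \<phi> \<psi>) (shift_psi \<phi> \<psi>) n"
    unfolding eigval_def dcoef_shift by (simp add: dcoef_def algebra_simps)
  moreover have c: "coeff (smult (1 / of_nat (Suc n)) (dd p)) n = 1"
    using coeff_dd[OF deg] n1 by (simp add: p1 del: of_nat_Suc)
  moreover have "degree (smult (1 / of_nat (Suc n)) (dd p)) = n"
    using degree_dd_le[OF deg] c by (intro le_antisym le_degree) (auto simp del: of_nat_Suc)
  ultimately show ?thesis
    unfolding eigenpoly_def by (simp add: lop_smult mult.commute)
qed

end

text \<open>The induction runs over all pairs: \<open>dd q\<close> divided by its leading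
  coefficient is a shifted eigenpolynomial of one degree less, and
  \<open>coeff_dd_subleading\<close> recovers the second coefficient of \<open>q\<close> from
  it.\<close>

lemma eigenpoly_subleading:
  assumes "degree \<phi> \<le> 2" "degree \<psi> \<le> 1" "eigenpoly \<phi> \<psi> (Suc n) q"
    and "\<And>j. j \<le> 2 * n \<Longrightarrow> dcoef \<phi> \<psi> (of_nat j) \<noteq> 0"
  shows "coeff q n = (of_nat n + 1) * ecoef \<phi> \<psi> (of_nat n) / dcoef \<phi> \<psi> (2 * of_nat n)
    + a * (of_nat n + 1) * of_nat n * (of_nat n - 1) / 6"
  using assms
proof (induction n arbitrary: \<phi> \<psi> q)
  case (0 \<phi> \<psi> q)
  obtain g0 g1 where g: "\<psi> = [:g0, g1:]" using 0(2) by (rule degree_le_1E)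
  have "degree q \<le> 1" using 0(3) by (simp add: eigenpoly_def)
  then obtain c0 c1 where q: "q = [:c0, c1:]" by (rule degree_le_1E)
  show ?case
    using 0(3) 0(4)[of 0]
    by (auto simp: q g eigenpoly_def lop_def dd_linear dd_const av_const eigval_def dcoef_def ecoef_def)
next
  case (Suc n \<phi> \<psi> q)
  let ?f = "shift_phi \<phi> \<psi>" and ?g = "shift_psi \<phi> \<psi>"
  note deg = Suc.prems(1,2)
  have q: "degree q \<le> Suc (Suc n)" "coeff q (Suc (Suc n)) = 1"
    using Suc.prems(3) by (simp_all add: eigenpoly_def)
  have d: "dcoef ?f ?g (of_nat j) \<noteq> 0" if "j \<le> 2 * n" for j
    using Suc.prems(4)[of "j + 2"] that by (simp add: dcoef_shift[OF deg] add.commute)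
  have D: "dcoef \<phi> \<psi> (2 * of_nat n + 2) \<noteq> 0"
    using Suc.prems(4)[of "2 * n + 2"] by (simp add: add.commute)
  have n0: "of_nat n + 1 \<noteq> (0::'a)" "of_nat n + 2 \<noteq> (0::'a)"
    using of_nat_neq_0[of n, where ?'a = 'a] of_nat_neq_0[of "Suc n", where ?'a = 'a]
    by (simp_all add: add.commute)
  have "coeff (smult (1 / of_nat (Suc (Suc n))) (dd q)) n =
      (of_nat n + 1) * ecoef ?f ?g (of_nat n) / dcoef ?f ?g (2 * of_nat n)
      + a * (of_nat n + 1) * of_nat n * (of_nat n - 1) / 6"
    by (rule Suc.IH[OF degree_shift_phi[OF deg] degree_shift_psi[OF deg] eigenpoly_shift[OF deg Suc.prems(3)] d])
  also have "coeff (smult (1 / of_nat (Suc (Suc n))) (dd q)) n =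
     ((of_nat n + 1) * coeff q (Suc n)
       + a * ((of_nat n + 2) * (of_nat n + 1) * (2 * of_nat n + 3)) / 12) / (of_nat n + 2)"
  proof -
    have "coeff (dd q) n = (of_nat n + 1) * coeff q (Suc n)
       + a * ((of_nat n + 2) * (of_nat n + 1) * (2 * of_nat n + 3)) / 12"
      using coeff_dd_subleading[OF q(1)] q(2) by (simp add: algebra_simps)
    moreover have "of_nat (Suc (Suc n)) = of_nat n + (2::'a)" by simp
    ultimately show ?thesis by simp
  qed
  finally have eq1: "(of_nat n + 1) * coeff q (Suc n) +
      a * ((of_nat n + 2) * (of_nat n + 1) * (2 * of_nat n + 3)) / 12 =
      ((of_nat n + 1) * (ecoef ?f ?g (of_nat n) / dcoef ?f ?g (2 * of_nat n))
      + a * (of_nat n + 1) * of_nat n * (of_nat n - 1) / 6) * (of_nat n + 2)"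
    using n0 by (simp only: divide_eq_eq times_divide_eq_right simp_thms if_False)
  define E where "E = ecoef ?f ?g (of_nat n) / dcoef ?f ?g (2 * of_nat n)"
  have "(of_nat n + 1) * coeff q (Suc n) =
      (of_nat n + 1) * ((of_nat n + 2) * (E + a * of_nat n * (of_nat n - 1) / 6)
        - a * ((of_nat n + 2) * (2 * of_nat n + 3)) / 12)"
    using eq1 unfolding E_def[symmetric] by (simp add: field_simps)
  then have eq: "coeff q (Suc n) = (of_nat n + 2) * (ecoef ?f ?g (of_nat n) / dcoef ?f ?g (2 * of_nat n)
      + a * of_nat n * (of_nat n - 1) / 6) - a * ((of_nat n + 2) * (2 * of_nat n + 3)) / 12"
    using n0(1) unfolding E_def by (simp only: mult_cancel_left simp_thms)
  have e: "ecoef ?f ?g (of_nat n) / dcoef ?f ?g (2 * of_nat n) =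
      ecoef \<phi> \<psi> (of_nat n + 1) / dcoef \<phi> \<psi> (2 * of_nat n + 2) + a * (2 * of_nat n + 1) / 4"
    using D by (simp add: ecoef_shift[OF deg] dcoef_shift[OF deg] field_simps)
  have "2 * of_nat (Suc n) = 2 * of_nat n + (2::'a)" "of_nat (Suc n) = of_nat n + (1::'a)" by simp_all
  then show ?case
    unfolding eq e by (simp only:) (simp add: field_simps)
qed

text \<open>For n = 0 the functional equation is tested on \<open>q\<close>. Otherwise both norms
  are transported to the shifted functional, where the polynomials have one degree less, and
  \<open>norm_ratio_shift\<close> matches the factors.\<close>

lemma eigenpoly_norm_ratio:
  assumes "degree \<phi> \<le> 2" "degree \<psi> \<le> 1" "solves u \<phi> \<psi>"
    and "eigenpoly \<phi> \<psi> n p" "eigenpoly \<phi> \<psi> (Suc n) q"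
    and "\<And>j. j \<le> 2 * n + 1 \<Longrightarrow> dcoef \<phi> \<psi> (of_nat j) \<noteq> 0"
  shows "u (q\<^sup>2) = norm_ratio \<phi> \<psi> n * u (p\<^sup>2)"
  using assms
proof (induction n arbitrary: \<phi> \<psi> u p q)
  case (0 \<phi> \<psi> u p q)
  obtain f0 f1 f2 where f: "\<phi> = [:f0, f1, f2:]" using 0(1) by (rule degree_le_2E)
  obtain g0 g1 where g: "\<psi> = [:g0, g1:]" using 0(2) by (rule degree_le_1E)
  have u: "Vector_Spaces.linear smult (*) u" and eq: "\<And>f. u (\<phi> * dd f + \<psi> * av f) = 0"
    using 0(3) by (simp_all add: solves_def)
  have const: "u [:k:] = k * u 1" for k
    using poly_functional_simps(3)[OF u, of k 1] by simp
  note u = poly_functional_simps[OF u]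
  have p: "p = 1"
    using 0(4) by (auto simp: eigenpoly_def one_pCons elim!: degree_eq_zeroE)
  have "degree q \<le> 1" using 0(5) by (simp add: eigenpoly_def)
  then obtain c0 c1 where q: "q = [:c0, c1:]" by (rule degree_le_1E)
  have g1: "g1 \<noteq> 0" "f2 + g1 \<noteq> 0"
    using 0(6)[of 0] 0(6)[of 1] by (simp_all add: dcoef_def f g numeral_2_eq_2)
  have q1: "c1 = 1" "g0 = g1 * c0"
    using 0(5) by (auto simp: q g eigenpoly_def lop_def dd_linear dd_const av_const eigval_def dcoef_def)
  \<comment> \<open>This is the derivative of \<phi> at -c0, the zero of \<open>q\<close>. Expanding
    \<phi> in powers of \<open>q\<close> and using \<open>u q = 0\<close> leaves only the square of
    \<open>q\<close> and the constant \<phi>(-c0).\<close>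
  define k where "k = f1 - 2 * f2 * c0"
  have "u \<psi> = 0" using eq[of 1] by simp
  moreover have "\<psi> = smult g1 q" by (simp add: g q q1)
  ultimately have uq: "u q = 0" using g1 by (simp add: u)
  have "\<phi> * dd q + \<psi> * av q =
      smult (f2 + g1) (q\<^sup>2) + smult (k + g1 * a / 4) q + [:poly \<phi> (- c0):]"
    by (simp add: f g q q1 dd_linear av_linear k_def power2_eq_square algebra_simps)
  then have "0 = (f2 + g1) * u (q\<^sup>2) + poly \<phi> (- c0) * u 1"
    using eq[of q] by (simp add: u uq const del: poly_pCons)
  then have "u (q\<^sup>2) = - (poly \<phi> (- c0) / (f2 + g1)) * u 1"
    using g1 by (simp add: field_simps eq_neg_iff_add_eq_0)
  moreover have "node \<phi> \<psi> 0 = - c0"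
    using g1 by (simp add: node_def ecoef_def dcoef_def f g q1)
  moreover have "phi_iter \<phi> \<psi> 0 = \<phi>"
    by (simp add: phi_iter_def f numeral_2_eq_2)
  moreover have "dcoef \<phi> \<psi> 1 = f2 + g1"
    by (simp add: dcoef_def f g numeral_2_eq_2)
  ultimately show ?case
    by (simp add: norm_ratio_def p)
next
  case (Suc n \<phi> \<psi> u p q)
  let ?f = "shift_phi \<phi> \<psi>" and ?g = "shift_psi \<phi> \<psi>" and ?v = "shift_functional u \<phi> \<psi>"
  note deg = Suc.prems(1,2)
  note v = shift_solves[OF Suc.prems(3)]
  then have lin: "Vector_Spaces.linear smult (*) ?v" by (simp add: solves_def)
  have ulin: "Vector_Spaces.linear smult (*) u" using Suc.prems(3) by (simp add: solves_def)
  \<comment> \<open>Summation by parts with both arguments equal to \<open>r\<close>, followed by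
    the eigenvalue relation.\<close>
  have norm: "?v ((smult k (dd r))\<^sup>2) = - k\<^sup>2 * eigval \<phi> \<psi> m * u (r\<^sup>2)" if "eigenpoly \<phi> \<psi> m r" for k r m
  proof -
    have "(smult k (dd r))\<^sup>2 = smult (k\<^sup>2) (dd r * dd r)" by (simp add: power2_eq_square)
    then show ?thesis
      using that shift_functional_dd[OF Suc.prems(3), of r r]
      by (simp add: poly_functional_simps[OF lin] poly_functional_simps[OF ulin]
          eigenpoly_def power2_eq_square)
  qed
  have d: "dcoef ?f ?g (of_nat j) \<noteq> 0" if "j \<le> 2 * n + 1" for j
    using Suc.prems(6)[of "j + 2"] that by (simp add: dcoef_shift[OF deg] add.commute)
  have D: "dcoef \<phi> \<psi> (of_nat n + 1) \<noteq> 0"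
    using Suc.prems(6)[of "n + 1"] by (simp add: add.commute)
  have n0: "of_nat n + 1 \<noteq> (0::'a)" "of_nat n + 2 \<noteq> (0::'a)"
    using of_nat_neq_0[of n, where ?'a = 'a] of_nat_neq_0[of "Suc n", where ?'a = 'a]
    by (simp_all add: add.commute)
  have n1: "of_nat (Suc n) = of_nat n + (1::'a)" "of_nat (Suc (Suc n)) = of_nat n + (2::'a)" by simp_all
  have eigval: "eigval \<phi> \<psi> (Suc n) = (of_nat n + 1) * dcoef \<phi> \<psi> (of_nat n)"
    "eigval \<phi> \<psi> (Suc (Suc n)) = (of_nat n + 2) * dcoef \<phi> \<psi> (of_nat n + 1)"
    by (simp_all add: eigval_def algebra_simps)
  have "?v ((smult (1 / of_nat (Suc (Suc n))) (dd q))\<^sup>2) =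
      norm_ratio ?f ?g n * ?v ((smult (1 / of_nat (Suc n)) (dd p))\<^sup>2)"
    by (rule Suc.IH[OF degree_shift_phi[OF deg] degree_shift_psi[OF deg] v
        eigenpoly_shift[OF deg Suc.prems(4)] eigenpoly_shift[OF deg Suc.prems(5)] d])
  then have "dcoef \<phi> \<psi> (of_nat n + 1) / (of_nat n + 2) * u (q\<^sup>2) =
      norm_ratio ?f ?g n * dcoef \<phi> \<psi> (of_nat n) / (of_nat n + 1) * u (p\<^sup>2)"
    unfolding norm[OF Suc.prems(4)] norm[OF Suc.prems(5)] eigval n1 using n0
    by (simp add: power2_eq_square)
  moreover have "norm_ratio \<phi> \<psi> (Suc n) =
    (of_nat n + 2) * dcoef \<phi> \<psi> (of_nat n) / ((of_nat n + 1) * dcoef \<phi> \<psi> (of_nat n + 1)) *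
    norm_ratio ?f ?g n"
    by (rule norm_ratio_shift[OF deg]) (use Suc.prems(6) in simp)
  moreover have "y = k2 * d0 / (k1 * d1) * r * x" if "d1 / k2 * y = r * d0 / k1 * x" "k1 \<noteq> 0" "k2 \<noteq> 0" "d1 \<noteq> 0"
    for x y r k1 k2 d0 d1 :: 'a
    using that by (simp add: field_simps)
  ultimately show ?case
    using n0 D by simp
qed

text \<open>
  If \<open>d\<^sub>j = 0\<close>, then \<open>L P\<^bsub>j+1\<^esub> = 0\<close>, so \<open>Q = dd P\<^bsub>j+1\<^esub>\<close> annihilates the shifted functional. Inverting the
  half-step shift turns this into \<open>u\<close> being annihilated by a polynomial of degree \<open>j + 2\<close>.
\<close>

lemma dcoef_nonzero_if_regular:
  assumes \<phi>: "degree \<phi> \<le> 2" and \<psi>: "degree \<psi> \<le> 1" and u: "solves u \<phi> \<psi>" "u 1 \<noteq> 0"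
    and nontrivial: "\<not> (\<phi> = 0 \<and> \<psi> = 0)"
    and regular: "\<And>w. (\<And>r. u (w * r) = 0) \<Longrightarrow> w = 0"
    and eigen: "eigenpoly \<phi> \<psi> (Suc j) p"
  shows "dcoef \<phi> \<psi> (of_nat j) \<noteq> 0"
proof
  assume d: "dcoef \<phi> \<psi> (of_nat j) = 0"
  have lin: "Vector_Spaces.linear smult (*) u" and eq: "\<And>f. u (\<phi> * dd f + \<psi> * av f) = 0"
    using u by (simp_all add: solves_def)
  obtain f0 f1 f2 where f: "\<phi> = [:f0, f1, f2:]" using \<phi> by (rule degree_le_2E)
  obtain g0 g1 where g: "\<psi> = [:g0, g1:]" using \<psi> by (rule degree_le_1E)
  show False
  proof (cases "f2 = 0")
    \<comment> \<open>With \<open>f2 = 0\<close> the vanishing of d_j forces \<open>g1 = 0\<close>;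
      testing the equation on 1 gives \<open>g0 = 0\<close>, and then surjectivity of
      \<open>dd\<close> makes \<phi> annihilate \<open>u\<close>.\<close>
    case True
    with d have "g1 = 0" by (simp add: dcoef_def f g numeral_2_eq_2)
    moreover have "u \<psi> = 0" using eq[of 1] by simp
    ultimately have "u (smult g0 1) = 0" by (simp add: g)
    then have "\<psi> = 0"
      using \<open>g1 = 0\<close> u(2) unfolding poly_functional_simps[OF lin] by (simp add: g)
    have "u (\<phi> * r) = 0" for r
      using eq dd_surj[of r] by (auto simp: \<open>\<psi> = 0\<close>)
    then have "\<phi> = 0" by (rule regular)
    with \<open>\<psi> = 0\<close> nontrivial show False by simp
  next
    case False
    define Q where "Q = dd p"
    have p: "degree p \<le> Suc j" "coeff p (Suc j) = 1" "lop \<phi> \<psi> p = 0"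
      using eigen d by (simp_all add: eigenpoly_def eigval_def)
    have Q: "degree Q \<le> j" "coeff Q j = of_nat (Suc j)"
      unfolding Q_def using degree_dd_le[OF p(1)] coeff_dd[OF p(1)] p(2) by simp_all
    have v: "shift_functional u \<phi> \<psi> (Q * s) = 0" for s
    proof -
      obtain q where "dd q = s" using dd_surj by blast
      then show ?thesis
        using shift_functional_dd[OF u(1), of q p]
        by (simp add: Q_def p(3) poly_functional_simps[OF lin] mult.commute)
    qed
    have "u ((\<phi> * av Q + \<psi> * [:t, a:] * dd Q) * r) = 0" for r
    proof -
      \<comment> \<open>\<open>s1\<close> and \<open>s2\<close> solve \<open>\<delta> r = \<delta> s1(s + 1/2) + s2(s + 1/2)\<close> as functions of \<open>s\<close>.\<close>
      define s1 where "s1 = av r + [:a/2:] * dd r"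
      define s2 where "s2 = [:a/2:] * [:a/2:] * dd r - [:t, a:] * dd r"
      have "(\<phi> * av Q + \<psi> * [:t, a:] * dd Q) * r =
          (\<phi> * av (Q * s1) + \<psi> * [:t, a:] * dd (Q * s1)) +
          (\<phi> * dd (Q * s2) + \<psi> * av (Q * s2))"
        unfolding s1_def s2_def operator_simps by algebra
      then show ?thesis
        using v[of s1] eq[of "Q * s2"]
        by (simp only: shift_functional_def poly_functional_simps(1)[OF lin] add_0)
    qed
    then have "\<phi> * av Q + \<psi> * [:t, a:] * dd Q = 0" by (rule regular)
    moreover have "coeff (\<phi> * av Q + \<psi> * [:t, a:] * dd Q) (Suc (Suc j)) = f2 * of_nat (Suc j)"
      using coeff_dd_eq_0[OF Q(1)] coeff_av_eq_0[OF Q(1)] coeff_av[OF Q(1)] Q(2)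
      by (simp add: f g)
    ultimately show False
      using False by (simp del: of_nat_Suc)
  qed
qed

end

section \<open>Orthogonal families\<close>

context
  fixes u :: "complex poly \<Rightarrow> complex" and I :: "nat set" and P :: "nat \<Rightarrow> complex poly"
  assumes lin: "Vector_Spaces.linear smult (*) u"
    and P: "monic_orthogonal_family u I P"
    and I: "\<forall>n\<in>I. \<forall>m\<le>n. m \<in> I"
begin

lemma monic_orthogonal_degree: "n \<in> I \<Longrightarrow> degree (P n) = n"
  and monic_orthogonal_coeff: "n \<in> I \<Longrightarrow> coeff (P n) n = 1"
  and monic_orthogonal_norm: "n \<in> I \<Longrightarrow> u ((P n)\<^sup>2) \<noteq> 0"
  and monic_orthogonal_less: "m < n \<Longrightarrow> n \<in> I \<Longrightarrow> u (P n * P m) = 0"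
  using P I less_imp_le[of m n] unfolding monic_orthogonal_family_def orthogonal_family_def by auto

text \<open>Subtracting multiples of lower members strips \<open>r\<close> coefficient by
  coefficient. The bound is on coefficients instead of the degree, so that n = 0 admits only the
  zero polynomial.\<close>

lemma monic_orthogonal_lower:
  assumes n: "n \<in> I" and r: "\<And>k. k \<ge> n \<Longrightarrow> coeff r k = 0"
  shows "u (P n * r) = 0"
proof -
  have "u (P n * r) = 0" if "m \<le> n" "\<forall>k\<ge>m. coeff r k = 0" for m r
    using that
  proof (induction m arbitrary: r)
    case 0
    then have "r = 0" by (simp add: poly_eq_iff)
    then show ?case by (simp add: poly_functional_simps[OF lin])
  next
    case (Suc m)
    define s where "s = r - smult (coeff r m) (P m)"
    have m: "m \<in> I" using I[rule_format, OF n] Suc.prems by simp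
    have "coeff s k = 0" if "k \<ge> m" for k
      using that Suc.prems(2) monic_orthogonal_degree[OF m] monic_orthogonal_coeff[OF m]
      by (cases "k = m") (auto simp: s_def coeff_eq_0)
    then have "u (P n * s) = 0" using Suc by simp
    moreover have "P n * r = P n * s + smult (coeff r m) (P n * P m)"
      by (simp add: s_def algebra_simps)
    ultimately show ?case
      using monic_orthogonal_less[of m n] n Suc.prems by (simp add: poly_functional_simps[OF lin])
  qed
  then show ?thesis using r by blast
qed

text \<open>Nondegeneracy of \<open>u\<close> below degree \<open>n\<close>: pairing
  \<open>r\<close> with the member of top index isolates its top coefficient times a nonzero
  norm.\<close>

lemma monic_orthogonal_zero:
  assumes "\<And>m. m < n \<Longrightarrow> m \<in> I" "\<And>k. k \<ge> n \<Longrightarrow> coeff r k = 0" "\<And>m. m < n \<Longrightarrow> u (P m * r) = 0"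
  shows "r = 0"
  using assms
proof (induction n)
  case 0
  then show ?case by (simp add: poly_eq_iff)
next
  case (Suc n)
  define s where "s = r - smult (coeff r n) (P n)"
  have n: "n \<in> I" using Suc.prems(1) by simp
  have "coeff s k = 0" if "k \<ge> n" for k
    using that Suc.prems(2) monic_orthogonal_degree[OF n] monic_orthogonal_coeff[OF n]
    by (cases "k = n") (auto simp: s_def coeff_eq_0)
  then have "u (P n * s) = 0" by (rule monic_orthogonal_lower[OF n])
  moreover have "P n * r = P n * s + smult (coeff r n) ((P n)\<^sup>2)"
    by (simp add: s_def algebra_simps power2_eq_square)
  ultimately have "coeff r n = 0"
    using Suc.prems(3)[of n] monic_orthogonal_norm[OF n] by (simp add: poly_functional_simps[OF lin])
  then have "coeff r k = 0" if "k \<ge> n" for k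
    using that Suc.prems(2)[of k] by (cases "k = n") auto
  then show ?case using Suc by simp
qed

text \<open>The choice of \<open>b\<close> removes the coefficient at \<open>n\<close> from the
  difference of the two sides, and \<open>c\<close> makes it orthogonal to \<open>P (n - 1)\<close>.
  Against lower members orthogonality is automatic, so nondegeneracy makes the difference
  zero.\<close>

lemma monic_orthogonal_three_term:
  assumes Sn: "Suc n \<in> I"
    and b: "b = (if n = 0 then 0 else coeff (P n) (n - 1)) - coeff (P (Suc n)) n"
    and c: "n > 0 \<Longrightarrow> u ((P n)\<^sup>2) = c * u ((P (n - 1))\<^sup>2)"
  shows "P (Suc n) = [:- b, 1:] * P n - (if n = 0 then 0 else smult c (P (n - 1)))"
proof -
  have n: "n \<in> I" "n - 1 \<in> I" using I[rule_format, OF Sn] by simp_all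
  note deg = monic_orthogonal_degree[OF Sn] monic_orthogonal_degree[OF n(1)]
    monic_orthogonal_degree[OF n(2)]
  define r where "r = P (Suc n) - ([:- b, 1:] * P n - (if n = 0 then 0 else smult c (P (n - 1))))"
  have "r = 0"
  proof (rule monic_orthogonal_zero[of n])
    show "m \<in> I" if "m < n" for m using I[rule_format, OF Sn] that by simp
    show "coeff r k = 0" if k: "k \<ge> n" for k
    proof -
      consider "k = n" | "k = Suc n" | "k > Suc n" using k by linarith
      then show ?thesis
        using deg monic_orthogonal_coeff[OF Sn] monic_orthogonal_coeff[OF n(1)]
        by cases (auto simp: r_def b coeff_pCons coeff_eq_0 split: nat.splits)
    qed
    show "u (P m * r) = 0" if "m < n" for m
    proof -
      have m: "m \<in> I" using I[rule_format, OF Sn] that by simp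
      have eq: "P m * r = P (Suc n) * P m + smult b (P n * P m) - P n * pCons 0 (P m)
          + smult c (P (n - 1) * P m)"
        using that by (simp add: r_def algebra_simps)
      have "u (P n * pCons 0 (P m)) = c * u (P (n - 1) * P m)"
      proof (cases "m = n - 1")
        case True
        \<comment> \<open>\<open>pCons 0 (P m)\<close> and \<open>P n\<close> are both monic of
          degree \<open>n\<close>, so their difference is orthogonal to \<open>P n\<close>.\<close>
        have "coeff (pCons 0 (P m) - P n) k = 0" if "k \<ge> n" for k
          using that \<open>m < n\<close> deg monic_orthogonal_coeff[OF m] monic_orthogonal_coeff[OF n(1)] True
          by (cases "k = n") (auto simp: coeff_pCons coeff_eq_0 split: nat.splits)
        then have "u (P n * (pCons 0 (P m) - P n)) = 0" by (rule monic_orthogonal_lower[OF n(1)])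
        then have "u (P n * pCons 0 (P m)) = u ((P n)\<^sup>2)"
          by (simp only: right_diff_distrib poly_functional_simps[OF lin] power2_eq_square) simp
        then show ?thesis using c \<open>m < n\<close> True by (simp add: power2_eq_square)
      next
        case False
        then have less: "m < n - 1" using that by simp
        have "coeff (pCons 0 (P m)) k = 0" if "k \<ge> n" for k
          using that less monic_orthogonal_degree[OF m]
          by (auto simp: coeff_pCons coeff_eq_0 split: nat.splits)
        then have "u (P n * pCons 0 (P m)) = 0" by (rule monic_orthogonal_lower[OF n(1)])
        then show ?thesis using monic_orthogonal_less[OF less n(2)] by simp
      qed
      then show ?thesis
        using monic_orthogonal_less[OF that n(1)] monic_orthogonal_less[of m "Suc n"] that Sn
        unfolding eq poly_functional_simps[OF lin] by simp
    qed
  qed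
  then show ?thesis by (simp add: r_def)
qed

end

lemma three_term_recurrence_unique:
  assumes "three_term_recurrence B C K P" "three_term_recurrence B C K Q" "\<And>m. m < n \<Longrightarrow> m \<in> K"
  shows "P n = Q n"
  using assms(3)
proof (induction n rule: less_induct)
  case (less n)
  show ?case
  proof (cases n)
    case 0
    then show ?thesis using assms(1,2) by (simp add: three_term_recurrence_def)
  next
    case (Suc k)
    then have "k \<in> K" using less.prems by simp
    moreover have "P k = Q k" "P (k - 1) = Q (k - 1)"
      using less Suc by auto
    ultimately show ?thesis
      using assms(1,2) unfolding three_term_recurrence_def Suc Suc_eq_plus1 by metis
  qed
qed

section \<open>Functionals solving the equation: orthogonal families and eigenpolynomials\<close>

locale quadratic_functional = quadratic_lattice a t for a t :: complex +
  fixes u :: "complex poly \<Rightarrow> complex" and \<phi> \<psi> :: "complex poly"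
  assumes degree_phi: "degree \<phi> \<le> 2" and degree_psi: "degree \<psi> \<le> 1"
    and solves: "solves u \<phi> \<psi>" and u_1: "u 1 \<noteq> 0"
begin

lemma linear_u: "Vector_Spaces.linear smult (*) u"
  using solves by (simp add: solves_def)

text \<open>The coefficients at \<open>n\<close> cancel in \<open>r\<close>, which therefore has
  lower degree; moving \<open>lop\<close> onto \<open>P m\<close> by symmetry shows \<open>r\<close>
  orthogonal to every lower member, hence zero.\<close>

lemma monic_orthogonal_eigenpoly:
  assumes P: "monic_orthogonal_family u I P" and I: "\<forall>n\<in>I. \<forall>m\<le>n. m \<in> I"
    and n: "n \<in> I"
  shows "eigenpoly \<phi> \<psi> n (P n)"
proof -
  note orth = linear_u P I
  define r where "r = lop \<phi> \<psi> (P n) - smult (eigval \<phi> \<psi> n) (P n)"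
  have deg: "degree (P m) = m" if "m \<le> n" for m
    using monic_orthogonal_degree[OF orth I[rule_format, OF n that]] .
  have c: "coeff (P n) n = 1" using monic_orthogonal_coeff[OF orth n] .
  have lop: "degree (lop \<phi> \<psi> (P m)) \<le> m" "coeff (lop \<phi> \<psi> (P m)) m = eigval \<phi> \<psi> m * coeff (P m) m"
    if "m \<le> n" for m
    using coeff_lop[OF degree_phi degree_psi, of "P m" m] deg[OF that] by simp_all
  have "r = 0"
  proof (rule monic_orthogonal_zero[OF orth, where n = n])
    show "m \<in> I" if "m < n" for m using that I[rule_format, OF n] by simp
    show "coeff r k = 0" if "k \<ge> n" for k
      using that lop[of n] deg[of n] c by (cases "k = n") (auto simp: r_def coeff_eq_0)
    show "u (P m * r) = 0" if m: "m < n" for m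
    proof -
      have "u (P m * r) = u (P n * lop \<phi> \<psi> (P m)) - eigval \<phi> \<psi> n * u (P n * P m)"
        using lop_symmetric[OF solves, of "P m" "P n"]
        by (simp add: r_def right_diff_distrib poly_functional_simps[OF linear_u] mult.commute)
      moreover have "u (P n * lop \<phi> \<psi> (P m)) = 0"
        by (rule monic_orthogonal_lower[OF orth n]) (use m lop(1)[of m] in \<open>auto intro: coeff_eq_0\<close>)
      ultimately show ?thesis using monic_orthogonal_less[OF orth m n] by simp
    qed
  qed
  then show ?thesis using deg[of n] c by (simp add: r_def eigenpoly_def)
qed

lemma eigenpoly_orthogonal:
  assumes "eigenpoly \<phi> \<psi> m p" "eigenpoly \<phi> \<psi> n q" "eigval \<phi> \<psi> m \<noteq> eigval \<phi> \<psi> n"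
  shows "u (q * p) = 0"
  using lop_symmetric[OF solves, of q p] assms
  by (simp add: eigenpoly_def poly_functional_simps[OF linear_u] mult.commute)

section \<open>Norms and recurrence on an initial segment \<open>I\<close>, with \<open>K\<close>
  the indices whose successor lies in \<open>I\<close>\<close>

context
  fixes I K :: "nat set"
  assumes I0: "0 \<in> I" and IK: "\<And>n. Suc n \<in> I \<longleftrightarrow> n \<in> K"
    and I: "\<forall>n\<in>I. \<forall>m\<le>n. m \<in> I"
    and dcoef: "\<forall>n\<in>K. \<forall>j\<le>2 * n + 1. dcoef \<phi> \<psi> (of_nat j) \<noteq> 0"
begin

lemma monic_orthogonal_norm_ratio:
  assumes "monic_orthogonal_family u I P" "n \<in> K"
  shows "u ((P (Suc n))\<^sup>2) = norm_ratio \<phi> \<psi> n * u ((P n)\<^sup>2)"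
proof -
  have n: "n \<in> I" "Suc n \<in> I" using assms(2) IK I by (meson le_SucI order_refl)+
  show ?thesis
    using dcoef[rule_format, OF assms(2)]
    by (intro eigenpoly_norm_ratio[OF degree_phi degree_psi solves]
        monic_orthogonal_eigenpoly[OF assms(1) I] n) simp
qed

text \<open>Forwards, each ratio links two nonzero norms. Backwards, eigenpolynomials form the
  family: distinct eigenvalues make them orthogonal, and their norms are products of ratios with
  \<open>u 1\<close>.\<close>

lemma monic_orthogonal_exists_iff:
  "(\<exists>P. monic_orthogonal_family u I P) \<longleftrightarrow> (\<forall>n\<in>K. norm_ratio \<phi> \<psi> n \<noteq> 0)"
proof
  assume "\<exists>P. monic_orthogonal_family u I P"
  then obtain P where P: "monic_orthogonal_family u I P" by blast
  show "\<forall>n\<in>K. norm_ratio \<phi> \<psi> n \<noteq> 0"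
  proof
    fix n assume n: "n \<in> K"
    then have "u ((P (Suc n))\<^sup>2) \<noteq> 0"
      using monic_orthogonal_norm[OF linear_u P I] IK by simp
    then show "norm_ratio \<phi> \<psi> n \<noteq> 0"
      using monic_orthogonal_norm_ratio[OF P n] by auto
  qed
next
  assume ratio: "\<forall>n\<in>K. norm_ratio \<phi> \<psi> n \<noteq> 0"
  have d: "dcoef \<phi> \<psi> (of_nat j) \<noteq> 0" if "n \<in> I" "n > 0" "j \<le> 2 * n - 2" for n j
    using that IK[of "n - 1"] dcoef[rule_format, of "n - 1" j] by simp
  have "\<exists>p. eigenpoly \<phi> \<psi> n p" if "n \<in> I" for n
  proof (cases "n = 0")
    case True
    then show ?thesis by (intro exI[of _ 1]) (simp add: eigenpoly_def eigval_def)
  next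
    case False
    then show ?thesis using d[OF that] by (intro eigenpoly_exists degree_phi degree_psi) simp
  qed
  then obtain P where P: "\<And>n. n \<in> I \<Longrightarrow> eigenpoly \<phi> \<psi> n (P n)" by metis
  have norm: "u ((P n)\<^sup>2) \<noteq> 0" if "n \<in> I" for n
    using that
  proof (induction n)
    case 0
    then have "P 0 = 1"
      using P[of 0] by (auto simp: eigenpoly_def one_pCons elim!: degree_eq_zeroE)
    then show ?case using u_1 by simp
  next
    case (Suc n)
    then have n: "n \<in> I" "n \<in> K" using I[rule_format, of "Suc n" n] IK by auto
    have "u ((P (Suc n))\<^sup>2) = norm_ratio \<phi> \<psi> n * u ((P n)\<^sup>2)"
      by (rule eigenpoly_norm_ratio[OF degree_phi degree_psi solves P[OF n(1)] P[OF Suc.prems]])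
        (use dcoef n in blast)
    then show ?case using Suc.IH n ratio by simp
  qed
  have "u (P n * P m) = 0" if "m \<in> I" "n \<in> I" "m < n" for m n
    by (rule eigenpoly_orthogonal[OF P[OF that(1)] P[OF that(2)] eigval_neq[OF that(3) d[OF that(2)]]])
      (use that in auto)
  then have "monic_orthogonal_family u I P"
    using P norm by (auto simp: monic_orthogonal_family_def orthogonal_family_def eigenpoly_def)
  then show "\<exists>P. monic_orthogonal_family u I P" by blast
qed

context
  fixes B C :: "nat \<Rightarrow> complex"
  assumes B0: "0 \<in> K \<Longrightarrow> B 0 = - ecoef \<phi> \<psi> 0 / dcoef \<phi> \<psi> 0"
    and B: "\<forall>n\<in>K. n > 0 \<longrightarrow>
      B n = of_nat n * ecoef \<phi> \<psi> (of_nat n - 1) / dcoef \<phi> \<psi> (2 * of_nat n - 2)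
        - (of_nat n + 1) * ecoef \<phi> \<psi> (of_nat n) / dcoef \<phi> \<psi> (2 * of_nat n)
        - 1 / 2 * a * of_nat n * (of_nat n - 1)"
    and C: "\<And>n. n \<in> K \<Longrightarrow> C (Suc n) = norm_ratio \<phi> \<psi> n"
begin

lemma monic_orthogonal_imp_three_term:
  assumes P: "monic_orthogonal_family u I P"
  shows "three_term_recurrence B C K P"
proof -
  note orth = linear_u P I
  note eigen = monic_orthogonal_eigenpoly[OF P I]
  have "P 0 = 1"
    using eigen[OF I0] by (auto simp: eigenpoly_def one_pCons elim!: degree_eq_zeroE)
  moreover have "P (n + 1) = [:- B n, 1:] * P n - (if n = 0 then 0 else smult (C n) (P (n - 1)))"
    if n: "n \<in> K" for n
  proof -
    have Sn: "Suc n \<in> I" using n IK by simp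
    have sub: "coeff (P (Suc m)) m = (of_nat m + 1) * ecoef \<phi> \<psi> (of_nat m) / dcoef \<phi> \<psi> (2 * of_nat m)
        + a * (of_nat m + 1) * of_nat m * (of_nat m - 1) / 6" if "m \<le> n" for m
    proof (rule eigenpoly_subleading[OF degree_phi degree_psi])
      show "eigenpoly \<phi> \<psi> (Suc m) (P (Suc m))"
        using that by (intro eigen I[rule_format, OF Sn]) simp
      show "dcoef \<phi> \<psi> (of_nat j) \<noteq> 0" if "j \<le> 2 * m" for j
        using that \<open>m \<le> n\<close> by (intro dcoef[rule_format, OF n]) simp
    qed
    have "B n = (if n = 0 then 0 else coeff (P n) (n - 1)) - coeff (P (Suc n)) n"
    proof (cases n)
      case 0
      then show ?thesis using B0 n sub[of 0] by simp
    next
      case (Suc m)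
      define x where "x = complex_of_nat m"
      define E1 E2 where "E1 = ecoef \<phi> \<psi> x / dcoef \<phi> \<psi> (2 * x)"
        and "E2 = ecoef \<phi> \<psi> (x + 1) / dcoef \<phi> \<psi> (2 * (x + 1))"
      have n0: "n > 0" "n - 1 = m" using Suc by simp_all
      have x: "of_nat n = x + 1" "x + 1 - 1 = x" "2 * (x + 1) - 2 = 2 * x"
        by (simp_all add: x_def Suc)
      have "B n = (x + 1) * E1 - (x + 1 + 1) * E2 - 1 / 2 * a * (x + 1) * x"
        using B[rule_format, OF n n0(1)] unfolding x E1_def E2_def times_divide_eq_right .
      \<comment> \<open>The cubic terms telescope: (x + 1)x(x - 1)/6 minus (x + 2)(x + 1)x/6 equals
        -(x + 1)x/2.\<close>
      also have "\<dots> = ((x + 1) * E1 + a * (x + 1) * x * (x - 1) / 6)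
          - ((x + 1 + 1) * E2 + a * (x + 1 + 1) * (x + 1) * x / 6)"
        by (simp add: field_simps)
      also have "(x + 1) * E1 + a * (x + 1) * x * (x - 1) / 6 = coeff (P n) m"
        using sub[of m] unfolding E1_def x_def times_divide_eq_right Suc by simp
      also have "(x + 1 + 1) * E2 + a * (x + 1 + 1) * (x + 1) * x / 6 = coeff (P (Suc n)) n"
        using sub[of n] unfolding E2_def x times_divide_eq_right by simp
      finally show ?thesis using n0 by simp
    qed
    moreover have "u ((P n)\<^sup>2) = C n * u ((P (n - 1))\<^sup>2)" if pos: "n > 0"
    proof -
      obtain m where m: "n = Suc m" using pos by (cases n) auto
      have "m \<in> K" using IK[of m] I[rule_format, OF Sn, of n] unfolding m by simp
      show ?thesis
        using monic_orthogonal_norm_ratio[OF P \<open>m \<in> K\<close>] C[OF \<open>m \<in> K\<close>] by (simp add: m)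
    qed
    ultimately show ?thesis
      unfolding Suc_eq_plus1[of n, symmetric] by (rule monic_orthogonal_three_term[OF orth Sn])
  qed
  ultimately show ?thesis unfolding three_term_recurrence_def by blast
qed

lemma below_in_K: "n \<in> I \<Longrightarrow> m < n \<Longrightarrow> m \<in> K"
  using I IK by (meson Suc_leI)

lemma monic_orthogonal_unique:
  assumes "monic_orthogonal_family u I P" "monic_orthogonal_family u I Q" "n \<in> I"
  shows "P n = Q n"
  by (rule three_term_recurrence_unique[OF monic_orthogonal_imp_three_term[OF assms(1)]
        monic_orthogonal_imp_three_term[OF assms(2)] below_in_K[OF assms(3)]])

text \<open>A sequence satisfying the recurrence agrees on \<open>I\<close> with the orthogonal
  family that the nonzero ratios provide, and orthogonality on \<open>I\<close> depends on these
  members alone.\<close>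

lemma monic_orthogonal_iff_three_term:
  assumes "\<forall>n\<in>K. norm_ratio \<phi> \<psi> n \<noteq> 0"
  shows "monic_orthogonal_family u I P \<longleftrightarrow> three_term_recurrence B C K P"
proof
  assume P: "three_term_recurrence B C K P"
  obtain Q where Q: "monic_orthogonal_family u I Q"
    using monic_orthogonal_exists_iff assms by blast
  have "P n = Q n" if "n \<in> I" for n
    by (rule three_term_recurrence_unique[OF P monic_orthogonal_imp_three_term[OF Q]
          below_in_K[OF that]])
  then show "monic_orthogonal_family u I P"
    using Q by (auto simp: monic_orthogonal_family_def orthogonal_family_def)
qed (rule monic_orthogonal_imp_three_term)

end
end

lemma dcoef_nonzero:
  assumes "\<not> (\<phi> = 0 \<and> \<psi> = 0)" and P: "monic_orthogonal_family u UNIV P"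
  shows "dcoef \<phi> \<psi> (of_nat j) \<noteq> 0"
proof (rule dcoef_nonzero_if_regular[OF degree_phi degree_psi solves u_1 assms(1)])
  show "w = 0" if "\<And>r. u (w * r) = 0" for w
    by (rule monic_orthogonal_zero[OF linear_u P, where n = "Suc (degree w)"])
      (use that in \<open>auto simp: mult.commute[of _ w] intro: coeff_eq_0\<close>)
  show "eigenpoly \<phi> \<psi> (Suc j) (P (Suc j))"
    by (rule monic_orthogonal_eigenpoly[OF P]) simp_all
qed

end

section \<open>From the lattice map to the operators\<close>

text \<open>A nonzero polynomial has finitely many roots, while \<open>X\<close> takes infinitely
  many values on \<open>U\<close>. This is the uniqueness behind \<open>divided_diff\<close> and
  \<open>average\<close>.\<close>

lemma admissible_poly_eqI:
  assumes "admissible h U X" "\<And>s. s \<in> U \<Longrightarrow> poly p (X s) = poly q (X s)"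
  shows "p = q"
proof (rule ccontr)
  assume "p \<noteq> q"
  then have "finite {x. poly (p - q) x = 0}" by (intro poly_roots_finite) simp
  moreover have "X ` U \<subseteq> {x. poly (p - q) x = 0}" using assms(2) by auto
  ultimately show False using assms(1) finite_subset by (auto simp: admissible_def)
qed

locale quadratic_branch =
  fixes h a b c s\<^sub>0 :: complex and U :: "complex set" and X :: "complex \<Rightarrow> complex" and t :: complex
  assumes U: "half_step_invariant h U" and X: "admissible h U X"
    and branch: "branch_law h U X 2 (a / 2)"
    and s0: "s\<^sub>0 \<in> U"
    and lattice: "\<forall>k :: int. X (s\<^sub>0 + of_int k * h) = a * (of_int k)\<^sup>2 + b * of_int k + c"
    and t: "t = (b\<^sup>2 - 4 * a * c) / 4"
begin

definition half_diff :: "complex \<Rightarrow> complex" where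
  "half_diff s = (fwd h X s - bwd h X s) / 2"

lemma fwd_eq: "s \<in> U \<Longrightarrow> fwd h X s = X s + a / 4 + half_diff s"
  and bwd_eq: "s \<in> U \<Longrightarrow> bwd h X s = X s + a / 4 - half_diff s"
proof -
  assume "s \<in> U"
  then have "fwd h X s + bwd h X s = 2 * X s + a / 2"
    using branch by (simp add: branch_law_def)
  then show "fwd h X s = X s + a / 4 + half_diff s" "bwd h X s = X s + a / 4 - half_diff s"
    by (simp_all add: half_diff_def field_simps) algebra+
qed

lemma half_diff_nonzero: "s \<in> U \<Longrightarrow> half_diff s \<noteq> 0"
  using X by (simp add: admissible_def parametrising_def half_diff_def)

lemma step_in_U: "s \<in> U \<Longrightarrow> s + h / 2 \<in> U" "s \<in> U \<Longrightarrow> s - h / 2 \<in> U"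
  using U by (auto simp: half_step_invariant_def)

lemma lattice_in_U: "s\<^sub>0 + of_int k * h \<in> U"
proof (induction k rule: int_induct[of _ 0])
  case base
  then show ?case using s0 by simp
next
  case (step1 i)
  then show ?case using step_in_U(1)[OF step_in_U(1)[OF step1(2)]] by (simp add: algebra_simps)
next
  case (step2 i)
  then show ?case using step_in_U(2)[OF step_in_U(2)[OF step2(2)]] by (simp add: algebra_simps)
qed

text \<open>The branch relation centred at the midpoint of two neighbouring lattice points expresses
  the value there through the two known ones.\<close>

lemma X_half_lattice:
  "X (s\<^sub>0 + of_int k * h + h / 2) = a * of_int k * (of_int k + 1) + b * (of_int k + 1 / 2) + c + a / 4"
proof -
  have "fwd h X (s\<^sub>0 + of_int k * h + h / 2) + bwd h X (s\<^sub>0 + of_int k * h + h / 2)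
      = 2 * X (s\<^sub>0 + of_int k * h + h / 2) + a / 2"
    using branch step_in_U(1)[OF lattice_in_U] by (simp add: branch_law_def)
  moreover have "fwd h X (s\<^sub>0 + of_int k * h + h / 2) = X (s\<^sub>0 + of_int (k + 1) * h)"
    "bwd h X (s\<^sub>0 + of_int k * h + h / 2) = X (s\<^sub>0 + of_int k * h)"
    by (simp_all add: fwd_def bwd_def algebra_simps)
  ultimately show ?thesis
    using lattice[rule_format, of k] lattice[rule_format, of "k + 1"]
    by (simp add: field_simps power2_eq_square)
qed

lemma half_diff_lattice: "half_diff (s\<^sub>0 + of_int k * h) = a * of_int k + b / 2"
proof -
  have "bwd h X (s\<^sub>0 + of_int k * h) = X (s\<^sub>0 + of_int (k - 1) * h + h / 2)"
    by (simp add: bwd_def algebra_simps)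
  then show ?thesis
    unfolding half_diff_def by (simp only: fwd_def X_half_lattice) (simp add: field_simps)
qed

text \<open>
  Admissibility for the cube makes \<open>\<delta>\<^sup>2\<close> a polynomial in \<open>X\<close> on all of \<open>U\<close>; it is identified from the
  single lattice through \<open>s\<^sub>0\<close>, which takes infinitely many values because \<open>b = 2 \<delta>(s\<^sub>0) \<noteq> 0\<close>.
\<close>

lemma half_diff_square:
  assumes "s \<in> U"
  shows "(half_diff s)\<^sup>2 = a * X s + t"
proof -
  have "degree (monom 1 3 :: complex poly) \<ge> 1" by (simp add: degree_monom_eq)
  then obtain Q where Q: "\<And>s. s \<in> U \<Longrightarrow> (poly (monom 1 3) (fwd h X s) - poly (monom 1 3) (bwd h X s)) /
       (fwd h X s - bwd h X s) = poly Q (X s)"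
    using X unfolding admissible_def by blast
  \<comment> \<open>With Y, Z = m \<plusminus> \<delta> and m = X + a/4, the divided difference of
    the cube is 3m^2 + \<delta>^2. So \<open>R\<close> measures the failure of the claim.\<close>
  define R where "R = Q - 3 * [:a / 4, 1:]\<^sup>2 - [:t, a:]"
  have R: "(half_diff s)\<^sup>2 = a * X s + t + poly R (X s)" if "s \<in> U" for s
  proof -
    have "fwd h X s - bwd h X s = 2 * half_diff s" by (simp add: half_diff_def)
    then have "poly Q (X s) = 3 * (X s + a / 4)\<^sup>2 + (half_diff s)\<^sup>2"
      unfolding Q[OF that, symmetric] using half_diff_nonzero[OF that]
      by (simp add: poly_monom fwd_eq bwd_eq that field_simps power2_eq_square power3_eq_cube)
    then show ?thesis
      by (simp add: R_def algebra_simps)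
  qed
  have "poly (pcompose R [:c, b, a:]) (of_int k) = 0" for k
  proof -
    have "a * X (s\<^sub>0 + of_int k * h) + t = (half_diff (s\<^sub>0 + of_int k * h))\<^sup>2"
      unfolding half_diff_lattice lattice[rule_format] t
      by (simp add: field_simps power2_eq_square)
    then have "poly R (X (s\<^sub>0 + of_int k * h)) = 0" using R[OF lattice_in_U] by simp
    then show ?thesis
      unfolding lattice[rule_format] by (simp add: poly_pcompose algebra_simps power2_eq_square)
  qed
  then have "range of_int \<subseteq> {x. poly (pcompose R [:c, b, a:]) x = 0}" by auto
  moreover have "infinite (range (of_int :: int \<Rightarrow> complex))"
    using finite_imageD[of "of_int :: int \<Rightarrow> complex" UNIV] infinite_UNIV_int by (auto simp: inj_on_def)
  ultimately have "pcompose R [:c, b, a:] = 0"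
    using poly_roots_finite finite_subset by blast
  moreover have "b \<noteq> 0"
    using half_diff_lattice[of 0] half_diff_nonzero[OF s0] by auto
  ultimately have "R = 0"
    by (auto dest: pcompose_eq_0)
  then show ?thesis using R[OF assms] by simp
qed

interpretation quadratic_lattice a t .

text \<open>The recursion of \<open>step_pair\<close> is what multiplication by Y or Z does to this
  decomposition once \<open>half_diff_square\<close> replaces \<delta>^2.\<close>

lemma poly_fwd_bwd:
  assumes "s \<in> U"
  shows "poly p (fwd h X s) = poly (av p) (X s) + half_diff s * poly (dd p) (X s) \<and>
    poly p (bwd h X s) = poly (av p) (X s) - half_diff s * poly (dd p) (X s)"
proof (induction p)
  case (pCons k p)
  show ?case
    using half_diff_square[OF assms] pCons.IH
    by (simp add: dd_pCons av_pCons fwd_eq bwd_eq assms) algebra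
qed simp

lemma divided_diff_eq: "divided_diff h U X p = dd p"
proof -
  have *: "(poly p (fwd h X s) - poly p (bwd h X s)) / (fwd h X s - bwd h X s) = poly (dd p) (X s)"
    if "s \<in> U" for s
    using poly_fwd_bwd[OF that, of p] half_diff_nonzero[OF that] by (simp add: half_diff_def)
  show ?thesis
    unfolding divided_diff_def
    by (rule the_equality) (auto simp: * intro: admissible_poly_eqI[OF X])
qed

lemma average_eq: "average h U X p = av p"
proof -
  have *: "(poly p (fwd h X s) + poly p (bwd h X s)) / 2 = poly (av p) (X s)" if "s \<in> U" for s
    using poly_fwd_bwd[OF that, of p] by simp
  show ?thesis
    unfolding average_def
    by (rule the_equality) (auto simp: * intro: admissible_poly_eqI[OF X])
qed

lemma solves_if_functional_eq:
  assumes "u \<in> poly_dual"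
    and "dual_divided_diff h U X (mult_functional \<phi> u) = dual_average h U X (mult_functional \<psi> u)"
  shows "solves u \<phi> \<psi>"
proof -
  have lin: "Vector_Spaces.linear smult (*) u" using assms(1) by (simp add: poly_dual_def)
  have "- u (\<phi> * dd f) = u (\<psi> * av f)" for f
    using fun_cong[OF assms(2), of f]
    by (simp add: dual_divided_diff_def dual_average_def mult_functional_def divided_diff_eq average_eq)
  then show ?thesis
    using lin unfolding solves_def
    by (simp add: poly_functional_simps(1)[OF lin] eq_neg_iff_add_eq_0 neg_eq_iff_add_eq_0)
qed

end

section \<open>Characterisation of orthogonality in the infinite and the finite case\<close>

theorem theorem7p8:
  fixes h a b c s\<^sub>0 :: complex
    and U :: "complex set"
    and X :: "complex \<Rightarrow> complex"
    and u :: "complex poly \<Rightarrow> complex"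
    and \<phi> \<psi> :: "complex poly"
    and \<phi>\<^sub>0 \<phi>\<^sub>1 \<phi>\<^sub>2 \<psi>\<^sub>0 \<psi>\<^sub>1 :: complex
    and d e B C :: "nat \<Rightarrow> complex"
    and \<Phi> :: "nat \<Rightarrow> complex poly"
    and \<xi> :: "nat \<Rightarrow> complex"
  assumes h: "h \<noteq> 0"
    and U: "half_step_invariant h U"
    and X: "admissible h U X"
    and branch: "branch_law h U X 2 (a / 2)"
    and u: "u \<in> poly_dual" "u 1 \<noteq> 0"
    and \<phi>: "\<phi> = [:\<phi>\<^sub>0, \<phi>\<^sub>1, \<phi>\<^sub>2:]"
    and \<psi>: "\<psi> = [:\<psi>\<^sub>0, \<psi>\<^sub>1:]"
    and nontrivial: "\<not> (\<phi> = 0 \<and> \<psi> = 0)"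
    and functional_eq: "dual_divided_diff h U X (mult_functional \<phi> u)
                          = dual_average h U X (mult_functional \<psi> u)"
    and s0: "s\<^sub>0 \<in> U"
    and lattice: "\<forall>k :: int. X (s\<^sub>0 + of_int k * h) = a * (of_int k)\<^sup>2 + b * of_int k + c"
    and d: "\<forall>n. d n = \<phi>\<^sub>2 * of_nat n + \<psi>\<^sub>1"
    and e: "\<forall>n. e n = \<phi>\<^sub>1 * of_nat n + \<psi>\<^sub>0 + 1 / 2 * a * \<psi>\<^sub>1 * (of_nat n)\<^sup>2"
    and \<Phi>: "\<forall>n. \<Phi> n =
      [: poly \<phi> (1 / 4 * a * (of_nat n)\<^sup>2)
           + 1 / 2 * a * of_nat n * poly \<psi> (1 / 4 * a * (of_nat n)\<^sup>2)
           + of_nat n / 4 * (b\<^sup>2 - 4 * a * c) * d n,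
         \<phi>\<^sub>1 + 3 / 2 * a * of_nat n * d n,
         \<phi>\<^sub>2 :]"
    and \<xi>: "\<forall>n. \<xi> n = - (1 / 4) * a * (of_nat n)\<^sup>2 - e n / d (2 * n)"
    and B0: "B 0 = - e 0 / d 0"
    and B: "\<forall>n\<ge>1. B n = of_nat n * e (n - 1) / d (2 * n - 2)
              - (of_nat n + 1) * e n / d (2 * n) - 1 / 2 * a * of_nat n * (of_nat n - 1)"
    and C1: "C 1 = - (1 / d 1) * poly (\<Phi> 0) (- e 0 / d 0)"
    and C: "\<forall>n\<ge>1. C (n + 1) =
              - ((of_nat n + 1) * d (n - 1) / (d (2 * n - 1) * d (2 * n + 1))) * poly (\<Phi> n) (\<xi> n)"
  shows
    "((\<exists>P. monic_orthogonal_family u UNIV P) \<longleftrightarrow>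
        (\<forall>j. d j \<noteq> 0) \<and> (\<forall>n. poly (\<Phi> n) (\<xi> n) \<noteq> 0))
     \<and>
     ((\<forall>j. d j \<noteq> 0) \<and> (\<forall>n. poly (\<Phi> n) (\<xi> n) \<noteq> 0) \<longrightarrow>
        (\<forall>P. monic_orthogonal_family u UNIV P \<longleftrightarrow> three_term_recurrence B C UNIV P) \<and>
        (\<exists>!P. monic_orthogonal_family u UNIV P))
     \<and>
     (\<forall>N. (\<forall>j\<le>2 * N + 1. d j \<noteq> 0) \<longrightarrow>
        ((\<exists>P. monic_orthogonal_family u {0..N + 1} P) \<longleftrightarrow>
           (\<forall>n\<le>N. poly (\<Phi> n) (\<xi> n) \<noteq> 0))
        \<and>
        ((\<forall>n\<le>N. poly (\<Phi> n) (\<xi> n) \<noteq> 0) \<longrightarrow>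
           (\<forall>P. monic_orthogonal_family u {0..N + 1} P \<longleftrightarrow>
                  three_term_recurrence B C {0..N} P) \<and>
           (\<forall>P P'. monic_orthogonal_family u {0..N + 1} P \<and>
                   monic_orthogonal_family u {0..N + 1} P' \<longrightarrow>
                   (\<forall>n\<in>{0..N + 1}. P n = P' n)) \<and>
           (\<forall>P. monic_orthogonal_family u {0..N + 1} P \<longrightarrow>
                C (N + 1) = u ((P (N + 1))\<^sup>2) / u ((P N)\<^sup>2))))"
proof -
  define t where "t = (b\<^sup>2 - 4 * a * c) / 4"
  interpret branch: quadratic_branch h a b c s\<^sub>0 U X t
    using U X branch s0 lattice t_def by unfold_locales
  interpret quadratic_functional a t u \<phi> \<psi>
    using u branch.solves_if_functional_eq[OF u(1) functional_eq]
    by unfold_locales (simp_all add: \<phi> \<psi>)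
  have d_eq: "d n = dcoef \<phi> \<psi> (of_nat n)" for n
    by (simp add: d dcoef_def \<phi> \<psi> numeral_2_eq_2)
  have e_eq: "e n = ecoef \<phi> \<psi> (of_nat n)" for n
    by (simp add: e ecoef_def \<phi> \<psi>)
  have \<Phi>_eq: "\<Phi> n = phi_iter \<phi> \<psi> (of_nat n)" for n
  proof -
    have "of_nat n / 4 * (b\<^sup>2 - 4 * a * c) * d n = of_nat n * t * d n" by (simp add: t_def)
    then show ?thesis
      unfolding phi_iter_def \<Phi>[rule_format] d_eq[symmetric] by (simp add: \<phi> numeral_2_eq_2)
  qed
  have \<xi>_eq: "\<xi> n = node \<phi> \<psi> (of_nat n)" for n
    by (simp add: \<xi> node_def e_eq d_eq)
  have pred: "of_nat n - 1 = complex_of_nat (n - 1)" "2 * of_nat n - 1 = complex_of_nat (2 * n - 1)"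
    "2 * of_nat n - 2 = complex_of_nat (2 * n - 2)" if "n > 0" for n
    using that by (simp_all add: of_nat_diff)
  have succ: "2 * of_nat n + 1 = complex_of_nat (2 * n + 1)" "2 * of_nat n = complex_of_nat (2 * n)" for n
    by simp_all
  have ratio: "norm_ratio \<phi> \<psi> n = (if n = 0 then - (1 / d 1)
      else - ((of_nat n + 1) * d (n - 1) / (d (2 * n - 1) * d (2 * n + 1)))) * poly (\<Phi> n) (\<xi> n)" for n
  proof (cases "n = 0")
    case True
    then show ?thesis by (simp add: norm_ratio_def \<Phi>_eq \<xi>_eq d_eq)
  next
    case False
    then have "n > 0" by simp
    show ?thesis
      unfolding norm_ratio_def \<Phi>_eq \<xi>_eq pred[OF \<open>n > 0\<close>] succ(1) d_eq using False by simp
  qed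
  have C_eq: "C (Suc n) = norm_ratio \<phi> \<psi> n" for n
    using C C1 by (cases "n = 0") (simp_all add: ratio \<xi>)
  have B_eq: "\<forall>n\<in>K. n > 0 \<longrightarrow>
      B n = of_nat n * ecoef \<phi> \<psi> (of_nat n - 1) / dcoef \<phi> \<psi> (2 * of_nat n - 2)
        - (of_nat n + 1) * ecoef \<phi> \<psi> (of_nat n) / dcoef \<phi> \<psi> (2 * of_nat n)
        - 1 / 2 * a * of_nat n * (of_nat n - 1)" for K
  proof (intro ballI impI)
    fix n :: nat assume "n > 0"
    then have "1 \<le> n" by simp
    from B[rule_format, OF this] show "B n = of_nat n * ecoef \<phi> \<psi> (of_nat n - 1) / dcoef \<phi> \<psi> (2 * of_nat n - 2)
        - (of_nat n + 1) * ecoef \<phi> \<psi> (of_nat n) / dcoef \<phi> \<psi> (2 * of_nat n)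
        - 1 / 2 * a * of_nat n * (of_nat n - 1)"
      unfolding pred(1,3)[OF \<open>n > 0\<close>] d_eq e_eq unfolding succ(2) .
  qed
  have B0_eq: "B 0 = - ecoef \<phi> \<psi> 0 / dcoef \<phi> \<psi> 0"
    using B0 by (simp add: d_eq e_eq)
  have ratio_nonzero: "norm_ratio \<phi> \<psi> n \<noteq> 0 \<longleftrightarrow> poly (\<Phi> n) (\<xi> n) \<noteq> 0"
    if "\<forall>j\<le>2 * n + 1. d j \<noteq> 0" for n
    using that of_nat_neq_0[of n, where ?'a = complex] by (simp add: ratio add.commute)

  \<comment> \<open>Both cases are instances: \<open>I = K = UNIV\<close>, and
    \<open>I = {0..N + 1}\<close> with \<open>K = {0..N}\<close>.\<close>
  have segment: "((\<exists>P. monic_orthogonal_family u I P) \<longleftrightarrow> (\<forall>n\<in>K. poly (\<Phi> n) (\<xi> n) \<noteq> 0)) \<and>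
      ((\<forall>n\<in>K. poly (\<Phi> n) (\<xi> n) \<noteq> 0) \<longrightarrow>
        (\<forall>P. monic_orthogonal_family u I P \<longleftrightarrow> three_term_recurrence B C K P) \<and>
        (\<forall>P P'. monic_orthogonal_family u I P \<and> monic_orthogonal_family u I P' \<longrightarrow>
           (\<forall>n\<in>I. P n = P' n)) \<and>
        (\<forall>P n. monic_orthogonal_family u I P \<and> n \<in> K \<longrightarrow>
           C (Suc n) = u ((P (Suc n))\<^sup>2) / u ((P n)\<^sup>2)))"
    if I0: "0 \<in> I" and IK: "\<And>n. Suc n \<in> I \<longleftrightarrow> n \<in> K" and I: "\<forall>n\<in>I. \<forall>m\<le>n. m \<in> I"
      and d0: "\<And>n j. n \<in> K \<Longrightarrow> j \<le> 2 * n + 1 \<Longrightarrow> d j \<noteq> 0" for I K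
  proof -
    have d0': "\<forall>n\<in>K. \<forall>j\<le>2 * n + 1. dcoef \<phi> \<psi> (of_nat j) \<noteq> 0"
      using d0 by (simp add: d_eq)
    have nonzero: "(\<forall>n\<in>K. norm_ratio \<phi> \<psi> n \<noteq> 0) \<longleftrightarrow> (\<forall>n\<in>K. poly (\<Phi> n) (\<xi> n) \<noteq> 0)"
      using ratio_nonzero d0 by blast
    note seg = I0 IK I d0'
    have "C (Suc n) = u ((P (Suc n))\<^sup>2) / u ((P n)\<^sup>2)"
      if P: "monic_orthogonal_family u I P" and n: "n \<in> K" for P n
    proof -
      have "n \<in> I" using IK I n by (meson le_SucI order_refl)
      then show ?thesis
        using monic_orthogonal_norm_ratio[OF seg P n] monic_orthogonal_norm[OF linear_u P I]
        by (simp add: C_eq)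
    qed
    then show ?thesis
      using monic_orthogonal_exists_iff[OF seg] monic_orthogonal_iff_three_term[OF seg B0_eq B_eq C_eq]
        monic_orthogonal_unique[OF seg B0_eq B_eq C_eq]
      unfolding nonzero by blast
  qed

  \<comment> \<open>Only the infinite case derives that no \<open>d j\<close> vanishes; in the
    finite case this is assumed up to 2N + 1.\<close>
  have necessary: "d j \<noteq> 0" if "\<exists>P. monic_orthogonal_family u UNIV P" for j
    using dcoef_nonzero[OF nontrivial] that by (auto simp: d_eq)
  have infinite: "(\<exists>P. monic_orthogonal_family u UNIV P) \<longleftrightarrow> (\<forall>n. poly (\<Phi> n) (\<xi> n) \<noteq> 0)"
    "(\<forall>n. poly (\<Phi> n) (\<xi> n) \<noteq> 0) \<Longrightarrow>
      (\<forall>P. monic_orthogonal_family u UNIV P \<longleftrightarrow> three_term_recurrence B C UNIV P) \<and>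
      (\<exists>!P. monic_orthogonal_family u UNIV P)" if "\<forall>j. d j \<noteq> 0"
  proof -
    note seg = segment[of UNIV UNIV]
    show ex: "(\<exists>P. monic_orthogonal_family u UNIV P) \<longleftrightarrow> (\<forall>n. poly (\<Phi> n) (\<xi> n) \<noteq> 0)"
      using seg that by simp
    assume nz: "\<forall>n. poly (\<Phi> n) (\<xi> n) \<noteq> 0"
    \<comment> \<open>Every index lies in \<open>UNIV\<close>, so agreement of the members is
      equality of the sequences.\<close>
    have "P = P'" if "monic_orthogonal_family u UNIV P" "monic_orthogonal_family u UNIV P'" for P P'
      using seg \<open>\<forall>j. d j \<noteq> 0\<close> nz that by (intro ext) simp
    then show "(\<forall>P. monic_orthogonal_family u UNIV P \<longleftrightarrow> three_term_recurrence B C UNIV P) \<and>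
      (\<exists>!P. monic_orthogonal_family u UNIV P)"
      using seg that nz ex by auto
  qed
  have finite: "((\<exists>P. monic_orthogonal_family u {0..N + 1} P) \<longleftrightarrow>
           (\<forall>n\<le>N. poly (\<Phi> n) (\<xi> n) \<noteq> 0))
        \<and>
        ((\<forall>n\<le>N. poly (\<Phi> n) (\<xi> n) \<noteq> 0) \<longrightarrow>
           (\<forall>P. monic_orthogonal_family u {0..N + 1} P \<longleftrightarrow>
                  three_term_recurrence B C {0..N} P) \<and>
           (\<forall>P P'. monic_orthogonal_family u {0..N + 1} P \<and>
                   monic_orthogonal_family u {0..N + 1} P' \<longrightarrow>
                   (\<forall>n\<in>{0..N + 1}. P n = P' n)) \<and>
           (\<forall>P. monic_orthogonal_family u {0..N + 1} P \<longrightarrow>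
                C (N + 1) = u ((P (N + 1))\<^sup>2) / u ((P N)\<^sup>2)))"
    if d0: "\<forall>j\<le>2 * N + 1. d j \<noteq> 0" for N
  proof -
    have le: "(\<forall>n\<in>{0..N}. Q n) \<longleftrightarrow> (\<forall>n\<le>N. Q n)" for Q by auto
    have "N \<in> {0..N}" by simp
    moreover have "d j \<noteq> 0" if "n \<in> {0..N}" "j \<le> 2 * n + 1" for n j
      using d0 that by auto
    ultimately show ?thesis
      using segment[of "{0..N + 1}" "{0..N}"] unfolding le Suc_eq_plus1 by auto
  qed
  show ?thesis
    using necessary infinite finite by blast
qed

end
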